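(* Let $G$ be a finite simple graph with vertex set $V$ and $\mathcal{T}^\circ=\{T^\circ_1,\dots,T^\circ_N\}$ a maximal design tubing on $G$ ($N=|V|$). Then the collection of cones \[ \mathcal{C}^{\square}(G,\mathcal{T}^\circ)=\Bigl\{\mathbb{R}_{\ge0}\{\mathbf{d}(\mathcal{T}^\circ,T):T\in\mathcal{T}\}:\mathcal{T}\text{ a design tubing on }G\Bigr\} \] is a complete simplicial fan in $\mathbb{R}^N$ which realizes the design nested complex $\mathcal{N}^\square(G)$ (i.e. the vectors of each design tubing are linearly independent and $\mathcal{T}\mapsto$ its cone is an isomorphism from $\mathcal{N}^\square(G)$ to the face poset of the fan).
   Context: Design tubes of $G$ are of two kinds: round tubes, i.e. nonempty subsets of $V$ inducing connected subgraphs (connected components included), and square tubes $[v]$, one for each vertex $v$. Two design tubes are compatible if either both are round and they are nested or disjoint and non-adjacent (their union is not a tube), or at least one is square and they are not nested (a square tube $[v]$ and a round tube $T$ are nested iff $v\in T$; distinct square tubes are not nested). A design tubing is a set of pairwise compatible design tubes; $\mathcal{N}^\square(G)$ is the simplicial complex of design tubings; maximal design tubings have $|V|$ elements. The compatibility degree of design tubes is $\delta(T\,\|\,T')=-1$ if $T=T'$; $1$ if $T,T'$ are nested and exactly one of them is square; the number of vertices of $T'\setminus T$ adjacent to some vertex of $T$ if both are round and $T\not\subseteq T'$; $0$ otherwise. The compatibility vector is $\mathbf{d}(\mathcal{T}^\circ,T)=(\delta(T^\circ_1\,\|\,T),\dots,\delta(T^\circ_N\,\|\,T))$. *)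

theory Defs
  imports "Graph_Theory.Graph_Theory" "HOL-Analysis.Analysis"
begin

text \<open>
  Graphs are finite simple graphs in the sense of the locale \<^locale>\<open>pair_graph\<close>: finite vertex set,
  symmetric irreflexive arc relation. The name \<open>connected\<close> is qualified throughout, since it
  also denotes topological connectedness.
\<close>

definition tube :: "'a pair_pre_digraph \<Rightarrow> 'a set \<Rightarrow> bool" where
  "tube G S \<longleftrightarrow> S \<noteq> {} \<and> S \<subseteq> pverts G \<and> Digraph_Component.connected (with_proj G \<restriction> S)"

datatype 'a design_tube = is_round: Round "'a set" | is_square: Square 'a

fun is_design_tube :: "'a pair_pre_digraph \<Rightarrow> 'a design_tube \<Rightarrow> bool" where
  "is_design_tube G (Round S) \<longleftrightarrow> tube G S"
| "is_design_tube G (Square v) \<longleftrightarrow> v \<in> pverts G"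

text \<open>
  \<open>nested\<close> and \<open>compatible_tubes\<close> are only ever relevant for distinct design tubes.
\<close>

fun nested :: "'a design_tube \<Rightarrow> 'a design_tube \<Rightarrow> bool" where
  "nested (Round S) (Round S') \<longleftrightarrow> S \<subseteq> S' \<or> S' \<subseteq> S"
| "nested (Square v) (Round S) \<longleftrightarrow> v \<in> S"
| "nested (Round S) (Square v) \<longleftrightarrow> v \<in> S"
| "nested (Square v) (Square w) \<longleftrightarrow> False"

fun compatible_tubes :: "'a pair_pre_digraph \<Rightarrow> 'a design_tube \<Rightarrow> 'a design_tube \<Rightarrow> bool" where
  "compatible_tubes G (Round S) (Round S') \<longleftrightarrow>
     nested (Round S) (Round S') \<or>
     S \<inter> S' = {} \<and> \<not> (\<exists>u\<in>S. \<exists>v\<in>S'. u \<rightarrow>\<^bsub>with_proj G\<^esub> v)"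
| "compatible_tubes G T T' \<longleftrightarrow> \<not> nested T T'"

definition design_tubing :: "'a pair_pre_digraph \<Rightarrow> 'a design_tube set \<Rightarrow> bool" where
  "design_tubing G \<T> \<longleftrightarrow> (\<forall>T\<in>\<T>. is_design_tube G T) \<and> pairwise (compatible_tubes G) \<T>"

definition design_nested_complex :: "'a pair_pre_digraph \<Rightarrow> 'a design_tube set set" where
  "design_nested_complex G = {\<T>. design_tubing G \<T>}"

definition maximal_design_tubing :: "'a pair_pre_digraph \<Rightarrow> 'a design_tube set \<Rightarrow> bool" where
  "maximal_design_tubing G \<T> \<longleftrightarrow>
     design_tubing G \<T> \<and> (\<forall>\<T>'. design_tubing G \<T>' \<and> \<T> \<subseteq> \<T>' \<longrightarrow> \<T>' = \<T>)"

fun round_degree :: "'a pair_pre_digraph \<Rightarrow> 'a design_tube \<Rightarrow> 'a design_tube \<Rightarrow> nat" where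
  "round_degree G (Round S) (Round S') =
     (if S \<subseteq> S' then 0 else card {v \<in> S' - S. \<exists>u\<in>S. u \<rightarrow>\<^bsub>with_proj G\<^esub> v})"
| "round_degree G T T' = 0"

definition compat_degree ::
    "'a pair_pre_digraph \<Rightarrow> 'a design_tube \<Rightarrow> 'a design_tube \<Rightarrow> int" where
  "compat_degree G T T' =
     (if T = T' then - 1
      else if nested T T' \<and> is_square T \<noteq> is_square T' then 1
      else int (round_degree G T T'))"

text \<open>The initial tubing is given as a family, since it labels the coordinates of the vectors.\<close>

definition compat_vector ::
    "'a pair_pre_digraph \<Rightarrow> ('n::finite \<Rightarrow> 'a design_tube) \<Rightarrow> 'a design_tube \<Rightarrow> real ^ 'n" where
  "compat_vector G T0 T = (\<chi> i. real_of_int (compat_degree G (T0 i) T))"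

text \<open>Note that \<open>convex_cone hull {} = {0}\<close>.\<close>

definition tubing_cone ::
    "'a pair_pre_digraph \<Rightarrow> ('n::finite \<Rightarrow> 'a design_tube) \<Rightarrow> 'a design_tube set \<Rightarrow> (real ^ 'n) set"
  where "tubing_cone G T0 \<T> = convex_cone hull (compat_vector G T0 ` \<T>)"

definition design_compat_fan ::
    "'a pair_pre_digraph \<Rightarrow> ('n::finite \<Rightarrow> 'a design_tube) \<Rightarrow> (real ^ 'n) set set" where
  "design_compat_fan G T0 = tubing_cone G T0 ` design_nested_complex G"

definition polyhedral_cone :: "'a::euclidean_space set \<Rightarrow> bool" where
  "polyhedral_cone C \<longleftrightarrow> (\<exists>B. finite B \<and> C = convex_cone hull B)"

definition simplicial_cone :: "'a::euclidean_space set \<Rightarrow> bool" where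
  "simplicial_cone C \<longleftrightarrow> (\<exists>B. finite B \<and> independent B \<and> C = convex_cone hull B)"

text \<open>The empty set satisfies \<open>face_of\<close> but does not count as a face of a cone.\<close>

definition polyhedral_fan :: "'a::euclidean_space set set \<Rightarrow> bool" where
  "polyhedral_fan F \<longleftrightarrow>
     finite F \<and> (\<forall>C\<in>F. polyhedral_cone C) \<and>
     (\<forall>C\<in>F. \<forall>D. D face_of C \<and> D \<noteq> {} \<longrightarrow> D \<in> F) \<and>
     (\<forall>C\<in>F. \<forall>D\<in>F. C \<inter> D face_of C \<and> C \<inter> D face_of D)"

definition complete_simplicial_fan :: "'a::euclidean_space set set \<Rightarrow> bool" where
  "complete_simplicial_fan F \<longleftrightarrow>
     polyhedral_fan F \<and> (\<forall>C\<in>F. simplicial_cone C) \<and> \<Union>F = UNIV"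

end

theory Submission
  imports Defs
begin

text \<open>
  Encode a weighted tubing \<open>c\<close> by the height function \<open>h v = (sum of c over round tubes containing v)
  - c [v]\<close>. This is a bijection between weighted tubings and real functions on the vertices: a round
  tube is a component of a superlevel set of the positive part of \<open>h\<close>. In terms of \<open>h\<close>, the
  coordinate of \<open>\<Sum>\<^sub>T c\<^sub>T d(T\<^sub>0, T)\<close> at a square tube \<open>[v]\<close> of the initial tubing is \<open>h v\<close>, and
  its coordinate at a round tube \<open>S\<close> is a piecewise linear expression that is strictly decreasing in
  one parameter \<open>s\<close> of \<open>h\<close> on \<open>S\<close> (the minimum of \<open>h\<close>, or the sum of its negative parts) and
  nondecreasing in the values of \<open>h\<close> at the neighbours of \<open>S\<close>. Going down the forest of initial
  tubes, this monotonicity shows that the coordinates determine \<open>h\<close>; since they are continuous and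
  positively homogeneous, invariance of domain makes them a bijection onto \<open>\<real>\<^sup>N\<close>. So every vector is
  in a unique way a nonnegative combination of the vectors of a tubing, which is the fan property.
\<close>

section \<open>Fans from unique conic representations\<close>

lemma convex_cone_hull_finite_image:
  assumes "finite A"
  shows "convex_cone hull (d ` A) = {x. \<exists>c. (\<forall>T\<in>A. 0 \<le> c T) \<and> x = (\<Sum>T\<in>A. c T *\<^sub>R d T)}"
    (is "_ = ?R")
proof
  have "convex_cone ?R"
    unfolding convex_cone_iff
  proof (intro conjI ballI impI allI)
    show "0 \<in> ?R" by (auto intro!: exI[of _ "\<lambda>_. 0"])
    fix x y assume "x \<in> ?R" "y \<in> ?R"
    then obtain a b where "\<forall>T\<in>A. 0 \<le> a T" "x = (\<Sum>T\<in>A. a T *\<^sub>R d T)"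
      "\<forall>T\<in>A. 0 \<le> b T" "y = (\<Sum>T\<in>A. b T *\<^sub>R d T)" by auto
    then show "x + y \<in> ?R"
      by (auto intro!: exI[of _ "\<lambda>T. a T + b T"] simp: scaleR_add_left sum.distrib)
  next
    fix x c assume "x \<in> ?R" and c: "0 \<le> (c::real)"
    then obtain a where "\<forall>T\<in>A. 0 \<le> a T" "x = (\<Sum>T\<in>A. a T *\<^sub>R d T)" by auto
    with c show "c *\<^sub>R x \<in> ?R"
      by (auto intro!: exI[of _ "\<lambda>T. c * a T"] simp: scaleR_sum_right)
  qed
  moreover have "d ` A \<subseteq> ?R"
  proof clarify
    fix T assume T: "T \<in> A"
    have "(\<Sum>U\<in>A. (if U = T then 1 else 0) *\<^sub>R d U) = (\<Sum>U\<in>A. if U = T then d U else 0)"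
      by (intro sum.cong) auto
    also have "\<dots> = d T" using T assms by simp
    finally show "\<exists>c. (\<forall>U\<in>A. 0 \<le> c U) \<and> d T = (\<Sum>U\<in>A. c U *\<^sub>R d U)"
      by (auto intro!: exI[of _ "\<lambda>U. if U = T then 1 else 0"])
  qed
  ultimately show "convex_cone hull (d ` A) \<subseteq> ?R" by (simp add: hull_minimal)
  show "?R \<subseteq> convex_cone hull (d ` A)"
  proof clarify
    fix c :: "_ \<Rightarrow> real" assume c: "\<forall>T\<in>A. 0 \<le> c T"
    from assms c show "(\<Sum>T\<in>A. c T *\<^sub>R d T) \<in> convex_cone hull (d ` A)"
    proof (induction A)
      case empty show ?case by simp
    next
      case (insert T A)
      have "convex_cone hull (d ` A) \<subseteq> convex_cone hull (d ` insert T A)"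
        by (intro hull_mono) auto
      with insert show ?case
        by (simp del: image_insert) (rule convex_cone_hull_add; blast intro: convex_cone_hull_mul hull_inc)
    qed
  qed
qed

text \<open>For \<open>r > 1\<close> a nonzero \<open>x\<close> is interior to the segment from
  \<open>0\<close> to \<open>r x\<close>, so the face contains both ends. Taking
  \<open>r = t + 2\<close> also puts \<open>t x\<close> on that segment.\<close>

lemma face_of_convex_cone_mult:
  assumes F: "F face_of C" and C: "convex_cone C" and x: "x \<in> F" and t: "0 \<le> t"
  shows "t *\<^sub>R x \<in> F"
proof (cases "x = 0")
  case True with x show ?thesis by simp
next
  case False
  have xC: "x \<in> C" using F x by (auto simp: face_of_def)
  define r where "r = t + 2"
  have 1: "0 \<in> C" "r *\<^sub>R x \<in> C" 
    using C xC t by (auto simp: convex_cone_iff r_def)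
  have seg: "x \<in> open_segment 0 (r *\<^sub>R x)"
    using False t by (auto simp: in_segment r_def intro!: exI[of _ "1 / (t+2)"])
  then have "0 \<in> F" "r *\<^sub>R x \<in> F" using F 1 x unfolding face_of_def by blast+
  moreover have "t *\<^sub>R x = (1 - t / r) *\<^sub>R 0 + (t / r) *\<^sub>R (r *\<^sub>R x)"
    using t by (simp add: r_def)
  moreover have "convex F" using F by (simp add: face_of_def)
  moreover have "0 \<le> t / r" "t / r \<le> 1" using t by (auto simp: r_def)
  ultimately show ?thesis by (metis convexD_alt)
qed

text \<open>The sum is the midpoint of \<open>2 x\<close> and \<open>2 y\<close>, so the face
  contains \<open>2 x\<close> and, by scaling, \<open>x\<close>. For \<open>x = y\<close> the open
  segment is empty, but the sum is \<open>2 x\<close> itself.\<close>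

lemma face_of_convex_cone_add_left:
  assumes F: "F face_of C" and C: "convex_cone C" and x: "x \<in> C" and y: "y \<in> C" and xy: "x + y \<in> F"
  shows "x \<in> F"
proof -
  have *: "2 *\<^sub>R x \<in> C" "2 *\<^sub>R y \<in> C" using C x y by (auto simp: convex_cone_iff)
  have eq: "x + y = (1 - 1/2) *\<^sub>R (2 *\<^sub>R x) + (1/2) *\<^sub>R (2 *\<^sub>R y)" by simp
  have "2 *\<^sub>R x \<in> F"
  proof (cases "x = y")
    case True with xy show ?thesis by (simp add: scaleR_2)
  next
    case False
    then have "x + y \<in> open_segment (2 *\<^sub>R x) (2 *\<^sub>R y)"
      unfolding in_segment using eq by (intro conjI exI[of _ "1/2"]) auto
    then show ?thesis using F * xy unfolding face_of_def by blast
  qed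
  then show ?thesis using face_of_convex_cone_mult[OF F C, of "2 *\<^sub>R x" "1/2"] by simp
qed

text \<open>A simplicial complex \<open>K\<close> on \<open>X\<close> for which each vector has
  exactly one nonnegative representation supported on a simplex. Coefficients are total functions,
  so representations over different simplices can be compared as functions.\<close>

locale conic_coordinates =
  fixes X :: "'b set" and K :: "'b set set" and d :: "'b \<Rightarrow> 'e::euclidean_space"
  assumes finite_X: "finite X"
    and K_subset: "A \<in> K \<Longrightarrow> A \<subseteq> X"
    and K_down: "A \<in> K \<Longrightarrow> B \<subseteq> A \<Longrightarrow> B \<in> K"
    and representable: "\<exists>c. (\<forall>T. 0 \<le> c T) \<and> {T. c T \<noteq> 0} \<in> K \<and> x = (\<Sum>T\<in>X. c T *\<^sub>R d T)"
    and unique: "\<forall>T. 0 \<le> c T \<Longrightarrow> {T. c T \<noteq> 0} \<in> K \<Longrightarrow> \<forall>T. 0 \<le> c' T \<Longrightarrow> {T. c' T \<noteq> 0} \<in> K \<Longrightarrow>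
       (\<Sum>T\<in>X. c T *\<^sub>R d T) = (\<Sum>T\<in>X. c' T *\<^sub>R d T) \<Longrightarrow> c = c'"
begin

section \<open>Cones over the simplices of a complex\<close>

definition cone_over :: "'b set \<Rightarrow> 'e set" where
  "cone_over A = convex_cone hull (d ` A)"

lemma finite_simplex: "A \<in> K \<Longrightarrow> finite A"
  using K_subset finite_X finite_subset by blast

text \<open>Extending coefficients by zero to \<open>X\<close> brings the points of all cones into
  the form to which \<open>unique\<close> applies.\<close>

lemma cone_over_eq:
  assumes "A \<in> K"
  shows "cone_over A =
    {x. \<exists>c. (\<forall>T. 0 \<le> c T) \<and> {T. c T \<noteq> 0} \<subseteq> A \<and> x = (\<Sum>T\<in>X. c T *\<^sub>R d T)}" (is "_ = ?R")
proof -
  have sub: "A \<subseteq> X" using assms K_subset by blast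
  have "\<exists>c'. (\<forall>T. 0 \<le> c' T) \<and> {T. c' T \<noteq> 0} \<subseteq> A \<and> (\<Sum>T\<in>A. c T *\<^sub>R d T) = (\<Sum>T\<in>X. c' T *\<^sub>R d T)"
    if "\<forall>T\<in>A. 0 \<le> c T" for c :: "'b \<Rightarrow> real"
    using that sub finite_X
    by (intro exI[of _ "\<lambda>T. if T \<in> A then c T else 0"])
      (auto simp: if_distrib[of "\<lambda>u. u *\<^sub>R _"] sum.inter_restrict[symmetric] Int_absorb1
        split: if_splits cong: if_cong)
  moreover have "(\<Sum>T\<in>X. c T *\<^sub>R d T) = (\<Sum>T\<in>A. c T *\<^sub>R d T)" if "{T. c T \<noteq> 0} \<subseteq> A" for c :: "'b \<Rightarrow> real"
    using that sub finite_X by (intro sum.mono_neutral_right) auto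
  ultimately show ?thesis
    unfolding cone_over_def convex_cone_hull_finite_image[OF finite_simplex[OF assms]] by blast
qed

lemma cone_overI:
  "A \<in> K \<Longrightarrow> \<forall>T. 0 \<le> c T \<Longrightarrow> {T. c T \<noteq> 0} \<subseteq> A \<Longrightarrow> (\<Sum>T\<in>X. c T *\<^sub>R d T) \<in> cone_over A"
  by (auto simp: cone_over_eq)

lemma convex_cone_cone_over: "convex_cone (cone_over A)"
  by (simp add: cone_over_def convex_cone_convex_cone_hull)

lemma gen_in_cone_over: "T \<in> A \<Longrightarrow> d T \<in> cone_over A"
  by (simp add: cone_over_def hull_inc)

lemma cone_over_mono: "A \<subseteq> B \<Longrightarrow> cone_over A \<subseteq> cone_over B"
  unfolding cone_over_def by (intro hull_mono) auto

lemma sum_indicator_scaleR: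
  "T \<in> X \<Longrightarrow> (\<Sum>U\<in>X. (if U = T then 1 else 0) *\<^sub>R d U) = d T"
  using finite_X by (simp add: if_distrib[of "\<lambda>u. u *\<^sub>R _"] cong: if_cong)

text \<open>The indicator function of \<open>T\<close> represents \<open>d T\<close>; by uniqueness
  it is also the representation over \<open>A\<close>.\<close>

lemma gen_in_cone_over_iff:
  assumes A: "A \<in> K" and T: "{T} \<in> K"
  shows "d T \<in> cone_over A \<longleftrightarrow> T \<in> A"
proof
  assume "d T \<in> cone_over A"
  then obtain c where c: "\<forall>T. 0 \<le> c T" "{T. c T \<noteq> 0} \<subseteq> A" "d T = (\<Sum>T\<in>X. c T *\<^sub>R d T)"
    using A by (auto simp: cone_over_eq)
  have eq: "(\<lambda>U. if U = T then 1 else 0) = c"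
    using c T K_down[OF A c(2)] K_subset[OF T]
    by (intro unique) (auto simp: sum_indicator_scaleR[simplified])
  have "c T = 1" using fun_cong[OF eq, of T] by simp
  with c show "T \<in> A" by auto
qed (rule gen_in_cone_over)

lemma cone_over_subset_iff:
  assumes "A \<in> K" "B \<in> K"
  shows "cone_over A \<subseteq> cone_over B \<longleftrightarrow> A \<subseteq> B"
proof
  assume sub: "cone_over A \<subseteq> cone_over B"
  show "A \<subseteq> B"
  proof
    fix T assume T: "T \<in> A"
    with sub have "d T \<in> cone_over B" using gen_in_cone_over by blast
    moreover have "{T} \<in> K" using K_down[OF assms(1)] T by blast
    ultimately show "T \<in> B" using gen_in_cone_over_iff assms by blast
  qed
qed (rule cone_over_mono)

lemma inj_on_gen:
  assumes "A \<in> K"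
  shows "inj_on d A"
proof (rule inj_onI)
  fix T U assume TU: "T \<in> A" "U \<in> A" "d T = d U"
  then have "{T} \<in> K" "{U} \<in> K" using K_down[OF assms] by auto
  moreover have "d T \<in> cone_over {U}" using TU gen_in_cone_over by auto
  ultimately show "T = U" using gen_in_cone_over_iff by blast
qed

text \<open>The positive and the negative part of a linear relation are two representations of the same vector.\<close>

lemma independent_gen:
  assumes A: "A \<in> K"
  shows "independent (d ` A)"
proof -
  have "u T = 0" if u: "(\<Sum>T\<in>A. u T *\<^sub>R d T) = 0" and T: "T \<in> A" for u T
  proof -
    define a b where "a T = (if T \<in> A then max 0 (u T) else 0)"
      and "b T = (if T \<in> A then max 0 (- u T) else 0)" for T
    have "(\<Sum>T\<in>X. a T *\<^sub>R d T) - (\<Sum>T\<in>X. b T *\<^sub>R d T) = (\<Sum>T\<in>X. (a T - b T) *\<^sub>R d T)"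
      by (simp add: sum_subtractf scaleR_diff_left)
    also have "\<dots> = (\<Sum>T\<in>A. u T *\<^sub>R d T)"
      using finite_X K_subset[OF A] by (intro sum.mono_neutral_cong_right) (auto simp: a_def b_def)
    finally have "(\<Sum>T\<in>X. a T *\<^sub>R d T) = (\<Sum>T\<in>X. b T *\<^sub>R d T)" using u by simp
    moreover have "{T. a T \<noteq> 0} \<in> K" "{T. b T \<noteq> 0} \<in> K"
      by (rule K_down[OF A], auto simp: a_def b_def split: if_splits)+
    ultimately have "a = b" by (intro unique) (auto simp: a_def b_def)
    then have "a T = b T" by simp
    then show ?thesis using T by (auto simp: a_def b_def max_def split: if_splits)
  qed
  then have "u (d T) = 0" if "(\<Sum>v\<in>d ` A. u v *\<^sub>R v) = 0" "T \<in> A" for u T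
    using that inj_on_gen[OF A] by (simp add: sum.reindex)
  then show ?thesis
    using finite_simplex[OF A] unfolding independent_explicit by blast
qed

lemma cone_over_Int:
  assumes A: "A \<in> K" and B: "B \<in> K"
  shows "cone_over A \<inter> cone_over B = cone_over (A \<inter> B)"
proof
  have AB: "A \<inter> B \<in> K" using K_down[OF A] by blast
  show "cone_over A \<inter> cone_over B \<subseteq> cone_over (A \<inter> B)"
  proof
    fix x assume "x \<in> cone_over A \<inter> cone_over B"
    then obtain a b where a: "\<forall>T. 0 \<le> a T" "{T. a T \<noteq> 0} \<subseteq> A" "x = (\<Sum>T\<in>X. a T *\<^sub>R d T)"
      and b: "\<forall>T. 0 \<le> b T" "{T. b T \<noteq> 0} \<subseteq> B" "x = (\<Sum>T\<in>X. b T *\<^sub>R d T)"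
      using A B by (auto simp: cone_over_eq)
    have "a = b" using a b K_down[OF A a(2)] K_down[OF B b(2)] by (intro unique) auto
    then show "x \<in> cone_over (A \<inter> B)" using a b AB by (auto simp: cone_over_eq)
  qed
qed (simp add: cone_over_mono)

text \<open>The mixture \<open>e\<close> of the coefficients of the end points represents
  \<open>x\<close> over \<open>B\<close>, so it is the representation over \<open>A\<close>. Where
  it vanishes, so do both of its nonnegative summands.\<close>

lemma cone_over_face:
  assumes B: "B \<in> K" and AB: "A \<subseteq> B"
  shows "cone_over A face_of cone_over B"
  unfolding face_of_def
proof (intro conjI ballI impI)
  have A: "A \<in> K" using K_down B AB by blast
  show "cone_over A \<subseteq> cone_over B" using AB by (rule cone_over_mono)
  show "convex (cone_over A)" by (simp add: cone_over_def convex_convex_cone_hull)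
  fix y z x assume yz: "y \<in> cone_over B" "z \<in> cone_over B" and x: "x \<in> cone_over A" and seg: "x \<in> open_segment y z"
  obtain a where a: "\<forall>T. 0 \<le> a T" "{T. a T \<noteq> 0} \<subseteq> B" "y = (\<Sum>T\<in>X. a T *\<^sub>R d T)"
    using yz B by (auto simp: cone_over_eq)
  obtain b where b: "\<forall>T. 0 \<le> b T" "{T. b T \<noteq> 0} \<subseteq> B" "z = (\<Sum>T\<in>X. b T *\<^sub>R d T)"
    using yz B by (auto simp: cone_over_eq)
  obtain c where c: "\<forall>T. 0 \<le> c T" "{T. c T \<noteq> 0} \<subseteq> A" "x = (\<Sum>T\<in>X. c T *\<^sub>R d T)"
    using x A by (auto simp: cone_over_eq)
  obtain t where t: "0 < t" "t < 1" "x = (1 - t) *\<^sub>R y + t *\<^sub>R z"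
    using seg by (auto simp: in_segment)
  define e where "e T = (1 - t) * a T + t * b T" for T
  have e0: "\<forall>T. 0 \<le> e T" using t a b by (auto simp: e_def)
  have "e T = 0" if "T \<notin> B" for T
  proof -
    have "a T = 0" "b T = 0" using that a(2) b(2) by blast+
    then show ?thesis by (simp add: e_def)
  qed
  then have eB: "{T. e T \<noteq> 0} \<subseteq> B" by auto
  have "x = (\<Sum>T\<in>X. e T *\<^sub>R d T)"
    unfolding t(3) a(3) b(3) e_def
    by (simp add: scaleR_add_left sum.distrib scaleR_sum_right)
  then have "e = c"
    using e0 c K_down[OF B eB] K_down[OF A c(2)] by (intro unique) auto
  have z: "a T = 0 \<and> b T = 0" if "T \<notin> A" for T
  proof -
    have "e T = 0" using that \<open>e = c\<close> c by auto
    then show ?thesis using a(1) b(1) t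
      by (auto simp: e_def add_nonneg_eq_0_iff)
  qed
  show "y \<in> cone_over A" "z \<in> cone_over A"
    unfolding a(3) b(3) using A a(1) b(1) z by (auto intro!: cone_overI)
qed

text \<open>The generators contained in \<open>F\<close> span it: a point of \<open>F\<close> is the
  sum of one term of its representation and a remainder in the cone, so the face property puts each
  nonzero term, hence its generator, into \<open>F\<close>.\<close>

lemma face_cone_over:
  assumes A: "A \<in> K" and F: "F face_of cone_over A" and ne: "F \<noteq> {}"
  shows "\<exists>B\<subseteq>A. F = cone_over B"
proof (intro exI conjI)
  let ?B = "{T \<in> A. d T \<in> F}"
  have B: "?B \<in> K" by (rule K_down[OF A]) auto
  have cc: "convex_cone F"
    unfolding convex_cone_def conic_def
    using ne F face_of_convex_cone_mult[OF F convex_cone_cone_over] by (auto simp: face_of_def)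
  show "?B \<subseteq> A" by auto
  show "F = cone_over ?B"
  proof
    show "cone_over ?B \<subseteq> F" unfolding cone_over_def using cc by (intro hull_minimal) auto
    show "F \<subseteq> cone_over ?B"
    proof
      fix x assume x: "x \<in> F"
      then have "x \<in> cone_over A" using F by (auto simp: face_of_def)
      then obtain c where c: "\<forall>T. 0 \<le> c T" "{T. c T \<noteq> 0} \<subseteq> A" "x = (\<Sum>T\<in>X. c T *\<^sub>R d T)"
        using A by (auto simp: cone_over_eq)
      have "d T \<in> F" if T: "c T \<noteq> 0" for T
      proof -
        have TX: "T \<in> X" using T c K_subset[OF A] by auto
        have 1: "c T *\<^sub>R d T \<in> cone_over A"
          using T c gen_in_cone_over[of T A] convex_cone_cone_over[of A] by (auto simp: convex_cone_iff)
        have 2: "(\<Sum>U\<in>X. (c(T := 0)) U *\<^sub>R d U) \<in> cone_over A"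
          unfolding cone_over_eq[OF A] using c
          by (intro CollectI exI[of _ "c(T := 0)"] conjI) (auto split: if_splits)
        have "(\<Sum>U\<in>X. (c(T := 0)) U *\<^sub>R d U) = (\<Sum>U\<in>X - {T}. c U *\<^sub>R d U)"
          using finite_X by (intro sum.mono_neutral_cong_right) auto
        then have "x = c T *\<^sub>R d T + (\<Sum>U\<in>X. (c(T := 0)) U *\<^sub>R d U)"
          using c(3) TX finite_X by (simp add: sum.remove)
        then have "c T *\<^sub>R d T \<in> F"
          using face_of_convex_cone_add_left[OF F convex_cone_cone_over 1 2] x by simp
        then have "(1 / c T) *\<^sub>R (c T *\<^sub>R d T) \<in> F"
          using c(1) by (intro face_of_convex_cone_mult[OF F convex_cone_cone_over, of "c T *\<^sub>R d T"]) auto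
        then show ?thesis using T by simp
      qed
      then show "x \<in> cone_over ?B" using c B by (auto simp: cone_over_eq)
    qed
  qed
qed

lemma complete_simplicial_fan_cones: "complete_simplicial_fan (cone_over ` K)"
  unfolding complete_simplicial_fan_def polyhedral_fan_def
proof (intro conjI ballI allI impI)
  have "K \<subseteq> Pow X" using K_subset by auto
  then show "finite (cone_over ` K)" using finite_X by (simp add: finite_subset)
next
  fix C assume "C \<in> cone_over ` K"
  then obtain A where A: "A \<in> K" "C = cone_over A" by auto
  then show "polyhedral_cone C" "simplicial_cone C"
    using independent_gen finite_simplex unfolding polyhedral_cone_def simplicial_cone_def cone_over_def by blast+
  fix D
  show "D \<in> cone_over ` K" if "D face_of C \<and> D \<noteq> {}"
    using that A face_cone_over[of A D] K_down[of A] by auto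
  show "C \<inter> D face_of C" "C \<inter> D face_of D" if "D \<in> cone_over ` K"
    using that A cone_over_Int cone_over_face by auto
next
  show "\<Union> (cone_over ` K) = UNIV"
  proof -
    have "\<exists>A\<in>K. x \<in> cone_over A" for x
    proof -
      obtain c where "\<forall>T. 0 \<le> c T" "{T. c T \<noteq> 0} \<in> K" "x = (\<Sum>T\<in>X. c T *\<^sub>R d T)"
        using representable by blast
      then show ?thesis by (intro bexI[of _ "{T. c T \<noteq> 0}"]) (auto simp: cone_over_eq)
    qed
    then show ?thesis by auto
  qed
qed

lemma inj_on_cone_over: "inj_on cone_over K"
  by (rule inj_onI) (metis cone_over_subset_iff subset_antisym order_refl)

lemma cone_over_face_iff:
  assumes "A \<in> K" "B \<in> K"
  shows "cone_over A face_of cone_over B \<longleftrightarrow> A \<subseteq> B"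
  using assms cone_over_face cone_over_subset_iff face_of_imp_subset by blast

end

section \<open>Tubes and weighted tubings\<close>

context pair_graph
begin

section \<open>Vertex neighbourhoods and connected sets\<close>

definition nbhd :: "'a set \<Rightarrow> 'a set" where
  "nbhd S = {v. v \<notin> S \<and> (\<exists>u\<in>S. (u, v) \<in> parcs G)}"

lemma parcs_sym: "(u, v) \<in> parcs G \<Longrightarrow> (v, u) \<in> parcs G"
  using pair_sym_arcs by (auto simp: symmetric_def elim: symE)

lemma nbhd_subset: "nbhd S \<subseteq> pverts G"
  by (auto simp: nbhd_def dest: in_arcsD2)

lemma finite_nbhd: "finite (nbhd S)"
  using nbhd_subset pair_finite_verts finite_subset by blast

text \<open>Connectedness as a cut condition. A path out of \<open>A\<close> must leave it along an
  edge; conversely, the set reachable from \<open>u\<close> inside \<open>S\<close> has no leaving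
  edge, so it is all of \<open>S\<close>.\<close>

lemma tube_iff:
  "tube G S \<longleftrightarrow> S \<noteq> {} \<and> S \<subseteq> pverts G \<and> (\<forall>A. A \<noteq> {} \<and> A \<subset> S \<longrightarrow> nbhd A \<inter> S \<noteq> {})"
proof -
  define R where "R = {(u, v) \<in> parcs G. u \<in> S \<and> v \<in> S}"
  have "(arcs_ends (with_proj G \<restriction> S))\<^sup>s = R"
    using parcs_sym by (auto simp: R_def arcs_ends_conv symcl_def)
  then have *: "Digraph_Component.connected (with_proj G \<restriction> S) \<longleftrightarrow>
      S \<noteq> {} \<and> (\<forall>u\<in>S. \<forall>v\<in>S. (u, v) \<in> rtrancl_on S R)"
    by (simp add: connected_conv)
  show ?thesis
  proof (intro iffI conjI allI impI)
    assume t: "tube G S"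
    then show "S \<noteq> {}" "S \<subseteq> pverts G" by (auto simp: tube_def)
    fix A assume A: "A \<noteq> {} \<and> A \<subset> S"
    then obtain a b where ab: "a \<in> A" "b \<in> S" "b \<notin> A" by auto
    have reach: "(a, b) \<in> rtrancl_on S R" using t A ab unfolding tube_def * by blast
    show "nbhd A \<inter> S \<noteq> {}"
    proof
      assume empty: "nbhd A \<inter> S = {}"
      from reach have "b \<in> A"
      proof (induction rule: rtrancl_on_induct)
        case base show ?case by (fact ab)
      next
        case (step u v)
        then show ?case using empty by (auto simp: R_def nbhd_def)
      qed
      then show False using ab by simp
    qed
  next
    assume r: "S \<noteq> {} \<and> S \<subseteq> pverts G \<and> (\<forall>A. A \<noteq> {} \<and> A \<subset> S \<longrightarrow> nbhd A \<inter> S \<noteq> {})"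
    have "(u, v) \<in> rtrancl_on S R" if uv: "u \<in> S" "v \<in> S" for u v
    proof (rule ccontr)
      assume n: "(u, v) \<notin> rtrancl_on S R"
      define A where "A = {w \<in> S. (u, w) \<in> rtrancl_on S R}"
      have "u \<in> A" "v \<notin> A" "A \<subseteq> S" using uv n by (auto simp: A_def)
      then obtain a w where aw: "a \<in> A" "w \<in> S" "w \<notin> A" "(a, w) \<in> parcs G"
        using r uv unfolding nbhd_def by blast
      then have "(a, w) \<in> R" "(u, a) \<in> rtrancl_on S R" by (auto simp: R_def A_def)
      then have "(u, w) \<in> rtrancl_on S R" using aw by (meson rtrancl_on_into_rtrancl_on)
      then show False using aw by (auto simp: A_def)
    qed
    then show "tube G S" using r unfolding tube_def * by blast
  qed
qed

lemma tube_subset: "tube G S \<Longrightarrow> S \<subseteq> pverts G"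
  and tube_nonempty: "tube G S \<Longrightarrow> S \<noteq> {}"
  by (auto simp: tube_def)

lemma finite_tube: "tube G S \<Longrightarrow> finite S"
  using tube_subset pair_finite_verts finite_subset by blast

lemma finite_tubes: "finite {S. tube G S \<and> P S}"
  by (rule finite_subset[of _ "Pow (pverts G)"]) (auto simp: tube_def pair_finite_verts)

lemma tube_crossing: "tube G S \<Longrightarrow> A \<inter> S \<noteq> {} \<Longrightarrow> \<not> S \<subseteq> A \<Longrightarrow> nbhd A \<inter> S \<noteq> {}"
proof -
  assume S: "tube G S" "A \<inter> S \<noteq> {}" "\<not> S \<subseteq> A"
  have "\<forall>A. A \<noteq> {} \<and> A \<subset> S \<longrightarrow> nbhd A \<inter> S \<noteq> {}" using S(1) unfolding tube_iff by (elim conjE)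
  moreover have "A \<inter> S \<noteq> {} \<and> A \<inter> S \<subset> S" using S(2,3) by auto
  ultimately have "nbhd (A \<inter> S) \<inter> S \<noteq> {}" by (elim allE impE)
  then show ?thesis by (auto simp: nbhd_def)
qed

lemma nbhd_sym: "nbhd S \<inter> T \<noteq> {} \<Longrightarrow> S \<inter> T = {} \<Longrightarrow> nbhd T \<inter> S \<noteq> {}"
  using parcs_sym unfolding nbhd_def by blast

text \<open>A set with no edge leaving it inside the union contains or misses each of the two tubes;
  containing just one is excluded by the common vertex or the joining edge.\<close>

lemma tube_Un:
  assumes S: "tube G S" and T: "tube G T" and ST: "S \<inter> T \<noteq> {} \<or> nbhd S \<inter> T \<noteq> {}"
  shows "tube G (S \<union> T)"
  unfolding tube_iff
proof (intro conjI allI impI)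
  show "S \<union> T \<noteq> {}" "S \<union> T \<subseteq> pverts G" using S T by (auto simp: tube_def)
  fix A assume A: "A \<noteq> {} \<and> A \<subset> S \<union> T"
  show "nbhd A \<inter> (S \<union> T) \<noteq> {}"
  proof
    assume e: "nbhd A \<inter> (S \<union> T) = {}"
    then have "A \<inter> S = {} \<or> S \<subseteq> A" "A \<inter> T = {} \<or> T \<subseteq> A"
      using tube_crossing[OF S, of A] tube_crossing[OF T, of A] by blast+
    then consider "S \<subseteq> A" "A \<inter> T = {}" | "T \<subseteq> A" "A \<inter> S = {}" using A by blast
    then show False
    proof cases
      case 1
      then have "nbhd S \<inter> T \<noteq> {}" using ST by blast
      then show False using 1 e unfolding nbhd_def by blast
    next
      case 2
      then have "nbhd T \<inter> S \<noteq> {}" using ST nbhd_sym by blast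
      then show False using 2 e unfolding nbhd_def by blast
    qed
  qed
qed

lemma tube_singleton: "v \<in> pverts G \<Longrightarrow> tube G {v}"
  by (auto simp: tube_iff)

lemma tube_insert:
  assumes "tube G S" "u \<in> nbhd S"
  shows "tube G (insert u S)"
  using tube_Un[OF assms(1) tube_singleton[of u]] assms nbhd_subset by auto

section \<open>Connected components of induced subgraphs, as maximal tubes\<close>

definition comps :: "'a set \<Rightarrow> 'a set set" where
  "comps W = {C. tube G C \<and> C \<subseteq> W \<and> (\<forall>T. tube G T \<and> T \<subseteq> W \<and> C \<subseteq> T \<longrightarrow> T = C)}"

lemma comps_tube: "C \<in> comps W \<Longrightarrow> tube G C"
  and comps_subset: "C \<in> comps W \<Longrightarrow> C \<subseteq> W"
  by (auto simp: comps_def)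

lemma finite_comps: "finite (comps W)"
  using finite_tubes[of "\<lambda>C. C \<in> comps W"] by (rule rev_finite_subset) (auto simp: comps_def)

lemma tube_subset_comp:
  assumes "tube G T" "T \<subseteq> W"
  obtains C where "C \<in> comps W" "T \<subseteq> C"
proof -
  have "T \<in> {S. tube G S \<and> S \<subseteq> W}" using assms by simp
  from finite_has_maximal2[OF finite_tubes this] obtain C where
    "tube G C" "C \<subseteq> W" "T \<subseteq> C" "\<forall>S. tube G S \<and> S \<subseteq> W \<and> C \<subseteq> S \<longrightarrow> C = S" by auto
  then have "C \<in> comps W" unfolding comps_def by blast
  then show thesis using \<open>T \<subseteq> C\<close> by (rule that)
qed

text \<open>Otherwise the union would be a tube inside \<open>W\<close>, against maximality.\<close>

lemma comps_separated:
  assumes C: "C \<in> comps W" and D: "D \<in> comps W" and ne: "C \<noteq> D"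
  shows "C \<inter> D = {} \<and> nbhd C \<inter> D = {}"
proof (rule ccontr)
  assume "\<not> ?thesis"
  then have "tube G (C \<union> D)" using C D by (intro tube_Un) (auto simp: comps_def)
  then have "C \<union> D = C" "C \<union> D = D" using C D by (auto simp: comps_def)
  then show False using ne by simp
qed

lemma Union_comps:
  assumes "W \<subseteq> pverts G"
  shows "\<Union> (comps W) = W"
proof
  show "W \<subseteq> \<Union> (comps W)"
  proof
    fix v assume "v \<in> W"
    then obtain C where "C \<in> comps W" "{v} \<subseteq> C"
      using assms tube_singleton[of v] by (auto elim: tube_subset_comp[of "{v}" W])
    then show "v \<in> \<Union> (comps W)" by auto
  qed
qed (auto dest: comps_subset)

lemma compatible_Round_iff:
  "compatible_tubes G (Round S) (Round T) \<longleftrightarrow> S \<subseteq> T \<or> T \<subseteq> S \<or> S \<inter> T = {} \<and> nbhd S \<inter> T = {}"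
  by (auto simp: nbhd_def)

lemma compatible_sym:
  assumes "compatible_tubes G T U"
  shows "compatible_tubes G U T"
  using assms
proof (cases T)
  case (Round S)
  then show ?thesis
    using assms parcs_sym by (cases U) (simp, blast, auto)
next
  case (Square v)
  then show ?thesis using assms by (cases U) auto
qed

text \<open>Compatible tubes covering a tube are not all missing part of it: a maximal one meeting the tube
  would have to be left along an edge, into an incompatible one.\<close>

lemma compatible_cover:
  assumes S: "tube G S" and fin: "finite F" and cov: "S \<subseteq> \<Union> F"
    and comp: "\<And>T U. T \<in> F \<Longrightarrow> U \<in> F \<Longrightarrow> compatible_tubes G (Round T) (Round U)"
  obtains T where "T \<in> F" "S \<subseteq> T"
proof -
  have "\<exists>T\<in>F. S \<subseteq> T"
  proof (rule ccontr)
    assume n: "\<not> (\<exists>T\<in>F. S \<subseteq> T)"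
    obtain a T where "a \<in> S" "a \<in> T" "T \<in> F" using tube_nonempty[OF S] cov by blast
    then have "{T \<in> F. T \<inter> S \<noteq> {}} \<noteq> {}" by blast
    moreover have "finite {T \<in> F. T \<inter> S \<noteq> {}}" using fin by simp
    ultimately have "\<exists>T\<in>{T \<in> F. T \<inter> S \<noteq> {}}. \<forall>U\<in>{T \<in> F. T \<inter> S \<noteq> {}}. T \<subseteq> U \<longrightarrow> T = U"
      by (intro finite_has_maximal)
    then obtain T where "T \<in> {T \<in> F. T \<inter> S \<noteq> {}}"
      "\<forall>U\<in>{T \<in> F. T \<inter> S \<noteq> {}}. T \<subseteq> U \<longrightarrow> T = U" by (elim bexE)
    then have T: "T \<in> F" "T \<inter> S \<noteq> {}"
      and mx: "U \<in> F \<Longrightarrow> U \<inter> S \<noteq> {} \<Longrightarrow> T \<subseteq> U \<Longrightarrow> T = U" for U by simp_all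
    have "nbhd T \<inter> S \<noteq> {}" using n T(1) by (intro tube_crossing[OF S T(2)]) blast
    then obtain u where u: "u \<in> nbhd T" "u \<in> S" by blast
    then obtain U where U: "U \<in> F" "u \<in> U" using cov by blast
    have "compatible_tubes G (Round T) (Round U)" using comp T U by blast
    moreover have "\<not> U \<subseteq> T" using u U by (auto simp: nbhd_def)
    ultimately have "T \<subseteq> U" using u U unfolding compatible_Round_iff by blast
    then have "T = U" using mx U u by blast
    then show False using \<open>\<not> U \<subseteq> T\<close> by simp
  qed
  then show thesis using that by blast
qed

section \<open>Weightings of tubings and their heights\<close>

definition weighting :: "('a design_tube \<Rightarrow> real) \<Rightarrow> bool" where
  "weighting c \<longleftrightarrow> (\<forall>T. 0 \<le> c T) \<and> design_tubing G {T. c T \<noteq> 0}"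

definition round_height :: "('a design_tube \<Rightarrow> real) \<Rightarrow> 'a \<Rightarrow> real" where
  "round_height c v = (\<Sum>S | tube G S \<and> v \<in> S. c (Round S))"

definition height :: "('a design_tube \<Rightarrow> real) \<Rightarrow> 'a \<Rightarrow> real" where
  "height c v = round_height c v - c (Square v)"

definition low :: "('a \<Rightarrow> real) \<Rightarrow> 'a set \<Rightarrow> real" where
  "low p S = Min (p ` S)"

text \<open>The added \<open>0\<close> is the value for empty \<open>N\<close>, so that connected
  components of \<open>G\<close>, which have no neighbours, obey the same formulas.\<close>

definition high :: "('a \<Rightarrow> real) \<Rightarrow> 'a set \<Rightarrow> real" where
  "high p N = Max (insert 0 (p ` N))"

lemma low_insert: "finite S \<Longrightarrow> S \<noteq> {} \<Longrightarrow> low p (insert u S) = min (p u) (low p S)"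
  by (simp add: low_def)

lemma weighting_nonneg: "weighting c \<Longrightarrow> 0 \<le> c T"
  by (simp add: weighting_def)

lemma weighting_design: "weighting c \<Longrightarrow> c T \<noteq> 0 \<Longrightarrow> is_design_tube G T"
  by (simp add: weighting_def design_tubing_def)

lemma weighting_compatible:
  "weighting c \<Longrightarrow> c T \<noteq> 0 \<Longrightarrow> c U \<noteq> 0 \<Longrightarrow> T \<noteq> U \<Longrightarrow> compatible_tubes G T U"
  by (auto simp: weighting_def design_tubing_def pairwise_def)

lemma weighting_Round_compatible:
  assumes "weighting c" "c (Round S) \<noteq> 0" "c (Round T) \<noteq> 0"
  shows "compatible_tubes G (Round S) (Round T)"
  using weighting_compatible[OF assms] by (cases "S = T") auto

lemma weighting_Square_zero:
  assumes "weighting c" "c (Round S) \<noteq> 0" "v \<in> S"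
  shows "c (Square v) = 0"
  using weighting_compatible[OF assms(1,2), of "Square v"] assms(3) by auto

lemma round_height_nonneg: "weighting c \<Longrightarrow> 0 \<le> round_height c v"
  unfolding round_height_def by (intro sum_nonneg weighting_nonneg)

lemma round_height_Square_zero:
  assumes "weighting c"
  shows "round_height c v = 0 \<or> c (Square v) = 0"
proof (rule disjCI)
  assume "c (Square v) \<noteq> 0"
  then show "round_height c v = 0"
    unfolding round_height_def using weighting_Square_zero[OF assms] by (intro sum.neutral) blast
qed

text \<open>Compatibility excludes a square tube and a round tube through the same vertex, so at
  most one of the two nonnegative parts of \<open>height\<close> is nonzero there.\<close>

lemma height_pos_part: "weighting c \<Longrightarrow> max 0 (height c v) = round_height c v"
  and height_neg_part: "weighting c \<Longrightarrow> max 0 (- height c v) = c (Square v)"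
  using round_height_Square_zero[of c v] round_height_nonneg[of c v] weighting_nonneg[of c "Square v"]
  by (auto simp: height_def max_def)

lemma height_outside: "weighting c \<Longrightarrow> v \<notin> pverts G \<Longrightarrow> height c v = 0"
proof -
  assume "weighting c" "v \<notin> pverts G"
  then have "c (Square v) = 0" "{S. tube G S \<and> v \<in> S} = {}"
    using weighting_design[of c "Square v"] tube_subset by auto
  then show ?thesis by (simp only: height_def round_height_def sum.empty diff_zero)
qed

section \<open>Recovering the weights from the heights\<close>

lemma sum_containing_subset:
  assumes w: "weighting c" and sub: "\<And>T. tube G T \<Longrightarrow> P T \<Longrightarrow> c (Round T) \<noteq> 0 \<Longrightarrow> Q T"
  shows "(\<Sum>T | tube G T \<and> P T. c (Round T)) \<le> (\<Sum>T | tube G T \<and> Q T. c (Round T))"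
proof -
  have "(\<Sum>T | tube G T \<and> P T. c (Round T)) = (\<Sum>T | tube G T \<and> (P T \<and> Q T). c (Round T))"
    using finite_tubes sub by (intro sum.mono_neutral_right) auto
  also have "\<dots> \<le> (\<Sum>T | tube G T \<and> Q T. c (Round T))"
    using finite_tubes weighting_nonneg[OF w] by (intro sum_mono2) auto
  finally show ?thesis .
qed

text \<open>By \<open>compatible_cover\<close>, the tubes of nonzero weight that do not contain
  \<open>S\<close> cannot cover it. A vertex of \<open>S\<close> outside all of them attains the
  minimum, as only tubes containing \<open>S\<close> contribute to its height.\<close>

lemma low_round_height:
  assumes w: "weighting c" and S: "tube G S"
  shows "low (round_height c) S = (\<Sum>T | tube G T \<and> S \<subseteq> T. c (Round T))"
proof -
  let ?F = "{T. tube G T \<and> c (Round T) \<noteq> 0 \<and> \<not> S \<subseteq> T}"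
  have "\<not> S \<subseteq> \<Union> ?F"
  proof
    assume cov: "S \<subseteq> \<Union> ?F"
    show False
      using compatible_cover[OF S finite_tubes cov] weighting_Round_compatible[OF w] by blast
  qed
  then obtain v where v: "v \<in> S" "\<And>T. tube G T \<Longrightarrow> c (Round T) \<noteq> 0 \<Longrightarrow> v \<in> T \<Longrightarrow> S \<subseteq> T" by blast
  show ?thesis unfolding low_def
  proof (rule Min_eqI)
    show "finite (round_height c ` S)" using finite_tube[OF S] by simp
    show "(\<Sum>T | tube G T \<and> S \<subseteq> T. c (Round T)) \<le> y" if "y \<in> round_height c ` S" for y
      using that w by (auto simp: round_height_def intro!: sum_containing_subset)
    have "round_height c v = (\<Sum>T | tube G T \<and> S \<subseteq> T. c (Round T))"
      using w v unfolding round_height_def by (intro antisym sum_containing_subset) auto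
    then show "(\<Sum>T | tube G T \<and> S \<subseteq> T. c (Round T)) \<in> round_height c ` S"
      by (rule image_eqI[OF sym v(1)])
  qed
qed

text \<open>For a neighbour \<open>u\<close>, the tubes containing the tube
  \<open>insert u S\<close> weigh \<open>min (round_height c u) ?m\<close>, which is at most
  \<open>?Z\<close>. Conversely, the smallest tube of nonzero weight strictly containing
  \<open>S\<close> contains some neighbour \<open>u\<close>, and by compatibility all the others
  contain that tube, so \<open>?Z\<close> is bounded by the minimum for this
  \<open>u\<close>.\<close>

lemma sum_strictly_containing:
  assumes w: "weighting c" and S: "tube G S"
  shows "(\<Sum>T | tube G T \<and> S \<subset> T. c (Round T)) =
    min (low (round_height c) S) (high (round_height c) (nbhd S))" (is "?Z = min ?m ?M")
proof -
  have ins: "(\<Sum>T | tube G T \<and> insert u S \<subseteq> T. c (Round T)) = min (round_height c u) ?m"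
    if "u \<in> nbhd S" for u
    using low_round_height[OF w tube_insert[OF S that]] low_insert finite_tube[OF S] tube_nonempty[OF S] by metis
  have le: "min (round_height c u) ?m \<le> ?Z" if "u \<in> nbhd S" for u
    unfolding ins[OF that, symmetric] using w that by (intro sum_containing_subset) (auto simp: nbhd_def)
  have m0: "0 \<le> ?m"
    unfolding low_round_height[OF w S] using weighting_nonneg[OF w] by (intro sum_nonneg)
  have M0: "0 \<le> ?M" unfolding high_def using finite_nbhd by (intro Max_ge) auto
  have "?M \<in> insert 0 (round_height c ` nbhd S)"
    unfolding high_def using finite_nbhd by (intro Max_in) auto
  moreover have "0 \<le> ?Z" using weighting_nonneg[OF w] by (intro sum_nonneg)
  ultimately have "min ?m ?M \<le> ?Z" using le m0 by (auto simp: min.commute)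
  moreover have "?Z \<le> min ?m ?M"
  proof (cases "\<exists>T. tube G T \<and> S \<subset> T \<and> c (Round T) \<noteq> 0")
    case True
    then have "{T. tube G T \<and> S \<subset> T \<and> c (Round T) \<noteq> 0} \<noteq> {}" by blast
    from finite_has_minimal[OF finite_tubes this]
    obtain T where "T \<in> {T. tube G T \<and> S \<subset> T \<and> c (Round T) \<noteq> 0}"
      "\<forall>U\<in>{T. tube G T \<and> S \<subset> T \<and> c (Round T) \<noteq> 0}. U \<subseteq> T \<longrightarrow> T = U" by (elim bexE)
    then have T: "tube G T" "S \<subset> T" "c (Round T) \<noteq> 0" and
      mn: "tube G U \<Longrightarrow> S \<subset> U \<Longrightarrow> c (Round U) \<noteq> 0 \<Longrightarrow> U \<subseteq> T \<Longrightarrow> T = U" for U by simp_all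
    obtain u where u: "u \<in> nbhd S" "u \<in> T" using tube_crossing[OF T(1), of S] T tube_nonempty[OF S] by blast
    have "T \<subseteq> U" if U: "tube G U" "S \<subset> U" "c (Round U) \<noteq> 0" for U
      using weighting_Round_compatible[OF w T(3) U(3)] mn[OF U] T(2) U(2) tube_nonempty[OF S]
      unfolding compatible_Round_iff by blast
    then have "?Z \<le> (\<Sum>T | tube G T \<and> insert u S \<subseteq> T. c (Round T))"
      using u by (intro sum_containing_subset[OF w]) blast
    also have "\<dots> = min (round_height c u) ?m" by (rule ins[OF u(1)])
    also have "\<dots> \<le> min ?m ?M"
    proof -
      have "round_height c u \<le> ?M" unfolding high_def using finite_nbhd u by (intro Max_ge) auto
      then show ?thesis by auto
    qed
    finally show ?thesis .
  next
    case False
    then have "?Z = 0" by (intro sum.neutral) blast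
    then show ?thesis using m0 M0 by simp
  qed
  ultimately show ?thesis by simp
qed

text \<open>The weight of \<open>S\<close> is that of all tubes containing \<open>S\<close> minus
  that of those strictly containing it, and \<open>a - min a b = max 0 (a - b)\<close>.\<close>

lemma weighting_Round_eq:
  assumes w: "weighting c" and S: "tube G S"
  shows "c (Round S) = max 0 (low (round_height c) S - high (round_height c) (nbhd S))"
proof -
  have "{T. tube G T \<and> S \<subseteq> T} = insert S {T. tube G T \<and> S \<subset> T}" using S by auto
  then have "low (round_height c) S = c (Round S) + (\<Sum>T | tube G T \<and> S \<subset> T. c (Round T))"
    using finite_tubes by (simp add: low_round_height[OF w S])
  then show ?thesis using sum_strictly_containing[OF w S] by (simp add: max_def min_def split: if_splits)
qed

lemma weighting_eqI:
  assumes w: "weighting c" and w': "weighting c'" and eq: "\<And>v. v \<in> pverts G \<Longrightarrow> height c v = height c' v"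
  shows "c = c'"
proof
  have h: "height c v = height c' v" for v using eq height_outside w w' by (cases "v \<in> pverts G") auto
  have r: "round_height c = round_height c'"
    using h height_pos_part[OF w] height_pos_part[OF w'] by (metis ext)
  fix T
  show "c T = c' T"
  proof (cases T)
    case (Round S)
    show ?thesis
    proof (cases "tube G S")
      case True
      then show ?thesis using weighting_Round_eq w w' r Round by metis
    next
      case False
      then have "c T = 0" "c' T = 0" using Round weighting_design[OF w, of T] weighting_design[OF w', of T] by auto
      then show ?thesis by simp
    qed
  next
    case (Square v)
    then show ?thesis using h height_neg_part[OF w, of v] height_neg_part[OF w', of v] by simp
  qed
qed

text \<open>Peel off the components of the support, each with the minimal value as its weight.\<close>

lemma round_height_surj:
  assumes "\<And>v. 0 \<le> p v" and "\<And>v. p v \<noteq> 0 \<Longrightarrow> v \<in> pverts G"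
  shows "\<exists>c. weighting c \<and> round_height c = p \<and> (\<forall>v. c (Square v) = 0)"
  using assms
proof (induction "card {v. p v \<noteq> 0}" arbitrary: p rule: less_induct)
  case less
  define W where "W = {v. p v \<noteq> 0}"
  have WV: "W \<subseteq> pverts G" using less.prems by (auto simp: W_def)
  then have fW: "finite W" using pair_finite_verts finite_subset by blast
  show ?case
  proof (cases "W = {}")
    case True
    then have "p = (\<lambda>_. 0)" by (auto simp: W_def)
    then show ?thesis
      by (intro exI[of _ "\<lambda>_. 0"]) (auto simp: weighting_def design_tubing_def round_height_def pairwise_def)
  next
    case False
    define m where "m = Min (p ` W)"
    define p' where "p' v = (if v \<in> W then p v - m else 0)" for v
    have "m \<in> p ` W" unfolding m_def using fW False by (intro Min_in) auto
    then obtain w where w: "w \<in> W" "p w = m" by auto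
    have m0: "0 < m" using w less.prems(1)[of w] by (auto simp: W_def less_le)
    have mle: "m \<le> p v" if "v \<in> W" for v unfolding m_def using fW that by (intro Min_le) auto
    have "{v. p' v \<noteq> 0} \<subset> W" using w by (auto simp: p'_def)
    then have "card {v. p' v \<noteq> 0} < card {v. p v \<noteq> 0}" using fW by (simp add: W_def psubset_card_mono)
    moreover have "0 \<le> p' v" for v using mle by (simp add: p'_def)
    moreover have "v \<in> pverts G" if "p' v \<noteq> 0" for v using that WV by (auto simp: p'_def split: if_splits)
    ultimately obtain c where c: "weighting c" "round_height c = p'" "\<And>v. c (Square v) = 0"
      using less.hyps[of p'] by auto
    have cW: "S \<subseteq> W" if S: "c (Round S) \<noteq> 0" for S
    proof
      fix v assume v: "v \<in> S"
      have "tube G S" using weighting_design[OF c(1) S] by simp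
      then have "c (Round S) \<le> round_height c v"
        unfolding round_height_def using v finite_tubes weighting_nonneg[OF c(1)]
        by (intro member_le_sum) auto
      then have "p' v \<noteq> 0" using S weighting_nonneg[OF c(1), of "Round S"] c(2) by auto
      then show "v \<in> W" by (auto simp: p'_def split: if_splits)
    qed
    \<comment> \<open>The value \<open>m\<close> is added to \<open>c\<close>, since a component on
      which \<open>p\<close> stays above \<open>m\<close> may already carry weight in
      \<open>c\<close>.\<close>
    define e where "e T = c T + (if T \<in> Round ` comps W then m else 0)" for T
    \<comment> \<open>A tube inside \<open>W\<close> lies in a single component, so it is nested in
      \<open>S\<close> or separated from it.\<close>
    have compat: "compatible_tubes G (Round S) (Round T)" if S: "S \<in> comps W" and T: "tube G T" "T \<subseteq> W" for S T
    proof -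
      obtain D where D: "D \<in> comps W" "T \<subseteq> D" using T by (rule tube_subset_comp)
      then show ?thesis using comps_separated[OF S D(1)] unfolding compatible_Round_iff by (cases "S = D") auto
    qed
    have e_round: "\<exists>S. T = Round S \<and> tube G S \<and> S \<subseteq> W \<and> (c T \<noteq> 0 \<or> S \<in> comps W)" if "e T \<noteq> 0" for T
    proof (cases T)
      case (Round S)
      then show ?thesis
        using that weighting_design[OF c(1), of T] cW[of S] comps_tube[of S W] comps_subset[of S W]
        by (auto simp: e_def split: if_splits)
    next
      case (Square v)
      then show ?thesis using that c(3) by (auto simp: e_def image_iff split: if_splits)
    qed
    have "compatible_tubes G T U" if "e T \<noteq> 0" "e U \<noteq> 0" "T \<noteq> U" for T U
      using e_round[OF that(1)] e_round[OF that(2)] compat compatible_sym weighting_compatible[OF c(1), of T U] that(3)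
      by metis
    moreover have "is_design_tube G T" if "e T \<noteq> 0" for T using e_round[OF that] by auto
    moreover have "0 \<le> e T" for T using weighting_nonneg[OF c(1)] m0 by (simp add: e_def)
    ultimately have "weighting e" by (auto simp: weighting_def design_tubing_def pairwise_def)
    moreover have "round_height e v = p v" for v
    proof -
      have "round_height e v = round_height c v + (\<Sum>S | tube G S \<and> v \<in> S. if S \<in> comps W then m else 0)"
        by (simp add: round_height_def e_def sum.distrib image_iff)
      also have "(\<Sum>S | tube G S \<and> v \<in> S. if S \<in> comps W then m else 0) = (\<Sum>S | S \<in> comps W \<and> v \<in> S. m)"
        using finite_tubes by (intro sum.mono_neutral_cong_right) (auto dest: comps_tube)
      also have "\<dots> = (if v \<in> W then m else 0)"
      proof (cases "v \<in> W")
        case True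
        then obtain C where C: "C \<in> comps W" "v \<in> C" using Union_comps[OF WV] by blast
        then have "{S. S \<in> comps W \<and> v \<in> S} = {C}" using comps_separated[OF C(1)] by blast
        then show ?thesis using True by simp
      next
        case False
        then have "{S. S \<in> comps W \<and> v \<in> S} = {}" by (auto dest: comps_subset)
        then show ?thesis using False by (simp only: sum.empty if_False)
      qed
      finally show ?thesis using c(2) by (auto simp: p'_def W_def)
    qed
    moreover have "e (Square v) = 0" for v using c(3) by (auto simp: e_def)
    ultimately show ?thesis by auto
  qed
qed

text \<open>The positive part of \<open>h\<close> yields the round weights, the negative part the
  square ones. Round tubes of nonzero weight contain only vertices with \<open>h > 0\<close>, so
  they are compatible with the square tubes, which sit where \<open>h < 0\<close>.\<close>

lemma height_surj:
  assumes h: "\<And>v. v \<notin> pverts G \<Longrightarrow> h v = 0"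
  shows "\<exists>c. weighting c \<and> height c = h"
proof -
  obtain c where c: "weighting c" "round_height c = (\<lambda>v. max 0 (h v))" "\<And>v. c (Square v) = 0"
  proof -
    have "v \<in> pverts G" if "max 0 (h v) \<noteq> 0" for v using that h[of v] by (cases "v \<in> pverts G") auto
    then show thesis using that round_height_surj[of "\<lambda>v. max 0 (h v)"] by auto
  qed
  define e where "e T = (case T of Round S \<Rightarrow> c T | Square v \<Rightarrow> max 0 (- h v))" for T
  have rs: "h v > 0" if "c (Round S) \<noteq> 0" "v \<in> S" for S v
  proof -
    have "tube G S" using weighting_design[OF c(1) that(1)] by simp
    then have "c (Round S) \<le> round_height c v"
      unfolding round_height_def using that finite_tubes weighting_nonneg[OF c(1)]
      by (intro member_le_sum) auto
    then have "0 < max 0 (h v)"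
      using that weighting_nonneg[OF c(1), of "Round S"] unfolding c(2) by linarith
    then show ?thesis by (simp add: max_def split: if_splits)
  qed
  have "weighting e"
    unfolding weighting_def design_tubing_def pairwise_def
  proof (intro conjI allI ballI impI)
    fix T show "0 \<le> e T" using weighting_nonneg[OF c(1)] by (simp add: e_def split: design_tube.split)
  next
    fix T assume "T \<in> {T. e T \<noteq> 0}"
    then show "is_design_tube G T"
      using weighting_design[OF c(1), of T] h by (cases T) (auto simp: e_def max_def split: if_splits)
  next
    fix T U assume "T \<in> {T. e T \<noteq> 0}" "U \<in> {T. e T \<noteq> 0}" "T \<noteq> U"
    then show "compatible_tubes G T U"
      using weighting_compatible[OF c(1), of T U] rs
      by (cases T; cases U) (force simp: e_def simp del: compatible_tubes.simps(1) split: if_splits)+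
  qed
  moreover have "height e v = h v" for v
    using fun_cong[OF c(2), of v] by (simp add: height_def round_height_def e_def max_def)
  ultimately show ?thesis by auto
qed

section \<open>Coordinates of a weighted tubing\<close>

text \<open>For a tube \<open>S\<close> with neighbourhood \<open>N\<close> and slack
  \<open>s\<close>, the terms are the contributions to the coordinate at \<open>S\<close> of the
  round tubes not containing \<open>S\<close>, of \<open>S\<close> itself with degree
  \<open>-1\<close>, and of the square tubes at vertices of \<open>S\<close>.\<close>

definition balance :: "'a set \<Rightarrow> ('a \<Rightarrow> real) \<Rightarrow> real \<Rightarrow> real" where
  "balance N h s = (\<Sum>u\<in>N. max 0 (max 0 (h u) - max 0 s))
     - max 0 (max 0 s - high (\<lambda>u. max 0 (h u)) N) + max 0 (- s)"

text \<open>At most one of the two terms is nonzero, so the slack encodes both of them.\<close>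

definition slack :: "('a \<Rightarrow> real) \<Rightarrow> 'a set \<Rightarrow> real" where
  "slack h S = low (\<lambda>v. max 0 (h v)) S - (\<Sum>v\<in>S. max 0 (- h v))"

fun coord :: "'a design_tube \<Rightarrow> ('a \<Rightarrow> real) \<Rightarrow> real" where
  "coord (Round S) h = balance (nbhd S) h (slack h S)"
| "coord (Square v) h = h v"

section \<open>Estimates for \<open>high\<close>, \<open>low\<close> and the slack\<close>

lemma high_mono:
  assumes N: "finite N" and le: "\<And>u. u \<in> N \<Longrightarrow> p u \<le> p' u"
  shows "high p N \<le> high p' N"
proof -
  have "p u \<le> Max (insert 0 (p' ` N))" if "u \<in> N" for u
    using le[OF that] N that by (intro order_trans[OF _ Max_ge[of _ "p' u"]]) auto
  moreover have "0 \<le> Max (insert 0 (p' ` N))" using N by (intro Max_ge) auto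
  ultimately show ?thesis unfolding high_def using N by (intro Max.boundedI) auto
qed

lemma low_pos_part_nonneg: "finite S \<Longrightarrow> S \<noteq> {} \<Longrightarrow> 0 \<le> low (\<lambda>v. max 0 (h v)) S"
  by (simp add: low_def)

lemma low_pos_part_zero:
  assumes "finite S" "v \<in> S" "h v \<le> 0"
  shows "low (\<lambda>v. max 0 (h v)) S = 0"
  unfolding low_def using assms by (intro Min_eqI) (auto simp: image_iff intro!: bexI[of _ v])

text \<open>A vertex of negative height makes the minimum of the positive parts \<open>0\<close>;
  without one, the sum of the negative parts is \<open>0\<close>.\<close>

lemma slack_parts:
  assumes S: "finite S" "S \<noteq> {}"
  shows "max 0 (slack h S) = low (\<lambda>v. max 0 (h v)) S"
    and "max 0 (- slack h S) = (\<Sum>v\<in>S. max 0 (- h v))"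
proof -
  have "low (\<lambda>v. max 0 (h v)) S = 0 \<or> (\<Sum>v\<in>S. max 0 (- h v)) = 0"
  proof (cases "\<exists>v\<in>S. h v < 0")
    case True
    then show ?thesis using low_pos_part_zero[OF S(1), of _ h] by auto
  next
    case False
    then have "(\<Sum>v\<in>S. max 0 (- h v)) = 0" by (intro sum.neutral) auto
    then show ?thesis ..
  qed
  moreover have "0 \<le> low (\<lambda>v. max 0 (h v)) S" using S by (rule low_pos_part_nonneg)
  moreover have "0 \<le> (\<Sum>v\<in>S. max 0 (- h v))" by (intro sum_nonneg) auto
  ultimately show "max 0 (slack h S) = low (\<lambda>v. max 0 (h v)) S"
    "max 0 (- slack h S) = (\<Sum>v\<in>S. max 0 (- h v))" by (auto simp: slack_def max_def)
qed

section \<open>Nonnegative combinations of compatibility vectors\<close>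

lemma sum_design_tubes:
  "(\<Sum>T | is_design_tube G T. f T) = (\<Sum>S | tube G S. f (Round S)) + (\<Sum>v\<in>pverts G. f (Square v))"
proof -
  have "{T. is_design_tube G T} = Round ` {S. tube G S} \<union> Square ` pverts G"
  proof (intro set_eqI)
    fix T show "T \<in> {T. is_design_tube G T} \<longleftrightarrow> T \<in> Round ` {S. tube G S} \<union> Square ` pverts G"
      by (cases T) auto
  qed
  then have "(\<Sum>T | is_design_tube G T. f T) = sum f (Round ` {S. tube G S}) + sum f (Square ` pverts G)"
    using finite_tubes[of "\<lambda>_. True"] pair_finite_verts by (simp only:) (intro sum.union_disjoint; auto)
  then show ?thesis by (simp add: sum.reindex inj_on_def)
qed

lemma finite_design_tubes: "finite {T. is_design_tube G T}"
proof -
  have "{T. is_design_tube G T} \<subseteq> Round ` Pow (pverts G) \<union> Square ` pverts G"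
  proof
    fix T assume "T \<in> {T. is_design_tube G T}"
    then show "T \<in> Round ` Pow (pverts G) \<union> Square ` pverts G" by (cases T) (auto simp: tube_def)
  qed
  then show ?thesis by (rule finite_subset) (simp add: pair_finite_verts)
qed

lemma compat_degree_Round_Round:
  "compat_degree G (Round S) (Round T) =
     (if T = S then - 1 else if S \<subseteq> T then 0 else int (card (nbhd S \<inter> T)))"
proof -
  have "{v \<in> T - S. \<exists>u\<in>S. u \<rightarrow>\<^bsub>with_proj G\<^esub> v} = nbhd S \<inter> T" by (auto simp: nbhd_def)
  then show ?thesis by (simp add: compat_degree_def)
qed

text \<open>For round \<open>S\<close>, the number of neighbours in a tube is written as a sum over
  neighbours and the sums are exchanged. The tubes containing \<open>u\<close> but not
  \<open>S\<close> weigh the round height of \<open>u\<close> less the weight of the tubes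
  containing \<open>insert u S\<close>.\<close>

lemma sum_compat_degree:
  assumes w: "weighting c" and D: "is_design_tube G D"
  shows "(\<Sum>T | is_design_tube G T. c T * real_of_int (compat_degree G D T)) = coord D (height c)"
proof (cases D)
  case (Square v)
  have "(\<Sum>S | tube G S. c (Round S) * real_of_int (compat_degree G D (Round S))) =
      (\<Sum>S | tube G S. if v \<in> S then c (Round S) else 0)"
    using Square by (intro sum.cong) (auto simp: compat_degree_def)
  also have "\<dots> = round_height c v"
    using finite_tubes[of "\<lambda>_. True"] unfolding round_height_def by (simp add: sum.If_cases Int_def)
  finally have 1: "(\<Sum>S | tube G S. c (Round S) * real_of_int (compat_degree G D (Round S))) = round_height c v" .
  have "(\<Sum>u\<in>pverts G. c (Square u) * real_of_int (compat_degree G D (Square u))) =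
      (\<Sum>u\<in>pverts G. if u = v then - c (Square u) else 0)"
    using Square by (intro sum.cong) (auto simp: compat_degree_def)
  also have "\<dots> = - c (Square v)" using D Square pair_finite_verts by simp
  finally show ?thesis using 1 Square by (simp add: sum_design_tubes height_def)
next
  case (Round S)
  then have S: "tube G S" using D by simp
  let ?p = "round_height c" and ?N = "nbhd S"
  have fS: "finite S" "S \<noteq> {}" using S finite_tube tube_nonempty by auto
  have hp: "(\<lambda>v. max 0 (height c v)) = ?p" using height_pos_part[OF w] by auto
  have fT: "finite {T. tube G T}" using finite_tubes[of "\<lambda>_. True"] by simp
  have "(\<Sum>T | tube G T. c (Round T) * real_of_int (compat_degree G D (Round T))) =
      (\<Sum>T | tube G T. (\<Sum>u\<in>?N. if u \<in> T \<and> \<not> S \<subseteq> T then c (Round T) else 0) - (if T = S then c (Round T) else 0))"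
  proof (intro sum.cong refl)
    fix T
    have "(\<Sum>u\<in>?N. if u \<in> T \<and> \<not> S \<subseteq> T then c (Round T) else 0) =
        (if S \<subseteq> T then 0 else c (Round T) * real (card (?N \<inter> T)))"
      using finite_nbhd by (simp add: sum.If_cases Int_def mult.commute)
    then show "c (Round T) * real_of_int (compat_degree G D (Round T)) =
      (\<Sum>u\<in>?N. if u \<in> T \<and> \<not> S \<subseteq> T then c (Round T) else 0) - (if T = S then c (Round T) else 0)"
      using Round by (auto simp: compat_degree_Round_Round)
  qed
  also have "\<dots> = (\<Sum>u\<in>?N. \<Sum>T | tube G T. if u \<in> T \<and> \<not> S \<subseteq> T then c (Round T) else 0) - c (Round S)"
    using S fT by (simp add: sum_subtractf sum.swap[of _ ?N])
  also have "(\<Sum>u\<in>?N. \<Sum>T | tube G T. if u \<in> T \<and> \<not> S \<subseteq> T then c (Round T) else 0) =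
      (\<Sum>u\<in>?N. max 0 (?p u - low ?p S))"
  proof (intro sum.cong refl)
    fix u assume u: "u \<in> ?N"
    have "?p u = (\<Sum>T | tube G T. if u \<in> T then c (Round T) else 0)"
      using fT unfolding round_height_def by (simp add: sum.If_cases Int_def)
    also have "\<dots> = (\<Sum>T | tube G T. (if u \<in> T \<and> \<not> S \<subseteq> T then c (Round T) else 0)
        + (if insert u S \<subseteq> T then c (Round T) else 0))"
      by (intro sum.cong) auto
    also have "\<dots> = (\<Sum>T | tube G T. if u \<in> T \<and> \<not> S \<subseteq> T then c (Round T) else 0)
        + (\<Sum>T | tube G T \<and> insert u S \<subseteq> T. c (Round T))"
      using fT by (simp add: sum.distrib sum.If_cases Int_def)
    also have "(\<Sum>T | tube G T \<and> insert u S \<subseteq> T. c (Round T)) = min (?p u) (low ?p S)"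
      using low_round_height[OF w tube_insert[OF S u]] low_insert[OF fS, of ?p u] by simp
    finally show "(\<Sum>T | tube G T. if u \<in> T \<and> \<not> S \<subseteq> T then c (Round T) else 0) = max 0 (?p u - low ?p S)"
      by linarith
  qed
  finally have 1: "(\<Sum>T | tube G T. c (Round T) * real_of_int (compat_degree G D (Round T))) =
      (\<Sum>u\<in>?N. max 0 (?p u - low ?p S)) - max 0 (low ?p S - high ?p ?N)"
    by (simp add: weighting_Round_eq[OF w S])
  have "(\<Sum>v\<in>pverts G. c (Square v) * real_of_int (compat_degree G D (Square v))) =
      (\<Sum>v\<in>pverts G. if v \<in> S then c (Square v) else 0)"
    using Round by (intro sum.cong) (auto simp: compat_degree_def)
  also have "\<dots> = (\<Sum>v\<in>S. c (Square v))"
    using pair_finite_verts tube_subset[OF S] by (simp add: sum.If_cases Int_absorb1)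
  finally have 2: "(\<Sum>v\<in>pverts G. c (Square v) * real_of_int (compat_degree G D (Square v))) =
      (\<Sum>v\<in>S. c (Square v))" .
  show ?thesis
    using 1 2 Round slack_parts[OF fS, of "height c"] height_neg_part[OF w] hp
    by (simp add: sum_design_tubes balance_def)
      (simp add: fun_eq_iff)
qed

section \<open>Monotonicity of the coordinates\<close>

lemma balance_mono:
  assumes N: "finite N" and le: "\<And>u. u \<in> N \<Longrightarrow> h u \<le> h' u"
  shows "balance N h s \<le> balance N h' s"
proof -
  have "(\<Sum>u\<in>N. max 0 (max 0 (h u) - max 0 s)) \<le> (\<Sum>u\<in>N. max 0 (max 0 (h' u) - max 0 s))"
    using le by (intro sum_mono) (auto simp: max_def intro: order_trans)
  moreover have "high (\<lambda>u. max 0 (h u)) N \<le> high (\<lambda>u. max 0 (h' u)) N"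
    using N le by (intro high_mono) (auto simp: max.coboundedI2)
  ultimately show ?thesis by (auto simp: balance_def)
qed

text \<open>All three terms are nonincreasing in \<open>s\<close>. The last is strict for
  \<open>s < 0\<close>, the middle one once \<open>s\<close> is nonnegative and at least
  \<open>high\<close>, and in between the sum is, through a neighbour higher than
  \<open>s\<close>.\<close>

lemma balance_strict_antimono:
  assumes N: "finite N" and s: "s < s'"
  shows "balance N h s' < balance N h s"
proof -
  let ?p = "\<lambda>u. max 0 (h u)"
  have le: "(\<Sum>u\<in>N. max 0 (?p u - max 0 s')) \<le> (\<Sum>u\<in>N. max 0 (?p u - max 0 s))"
    using s by (intro sum_mono) auto
  consider "s < 0" | "0 \<le> s" "high ?p N \<le> s" | "0 \<le> s" "s < high ?p N" by linarith
  then show ?thesis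
  proof cases
    case 1 then show ?thesis using le s by (auto simp: balance_def max_def split: if_splits)
  next
    case 2 then show ?thesis using le s by (auto simp: balance_def)
  next
    case 3
    have "high ?p N \<in> insert 0 (?p ` N)" unfolding high_def using N by (intro Max_in) auto
    then obtain u where "u \<in> N" "s < ?p u" using 3 by auto
    then have "(\<Sum>u\<in>N. max 0 (?p u - max 0 s')) < (\<Sum>u\<in>N. max 0 (?p u - max 0 s))"
      using s 3 N by (intro sum_strict_mono_ex1) (auto intro!: bexI[of _ u])
    then show ?thesis using s 3 by (auto simp: balance_def)
  qed
qed

text \<open>Raising \<open>h\<close> at \<open>v\<close> alone, as in \<open>g\<close>, already
  increases the sum: by \<open>max 0 s \<le> h v\<close> the term of \<open>v\<close> is in its
  strictly increasing range. The other changes cannot lower the balance.\<close>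

lemma balance_strict_mono:
  assumes N: "finite N" and le: "\<And>u. u \<in> N \<Longrightarrow> h u \<le> h' u"
    and v: "v \<in> N" "h v < h' v" "max 0 s \<le> h v"
  shows "balance N h s < balance N h' s"
proof -
  define g where "g = h(v := h' v)"
  have "high (\<lambda>u. max 0 (h u)) N \<le> high (\<lambda>u. max 0 (g u)) N"
    using N v(2) by (intro high_mono) (auto simp: g_def)
  moreover have "(\<Sum>u\<in>N. max 0 (max 0 (h u) - max 0 s)) < (\<Sum>u\<in>N. max 0 (max 0 (g u) - max 0 s))"
    using v N by (intro sum_strict_mono_ex1) (auto simp: g_def intro!: bexI[of _ v])
  ultimately have "balance N h s < balance N g s" by (auto simp: balance_def)
  also have "\<dots> \<le> balance N h' s" using N le by (intro balance_mono) (auto simp: g_def)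
  finally show ?thesis .
qed

text \<open>Raising \<open>h\<close> at the root raises the slack of every component of \<open>S - {v}\<close>, strictly for those
  that could otherwise keep the slack of \<open>S\<close> unchanged; but that slack is determined by the
  coordinate of \<open>S\<close>.\<close>

lemma coord_Round_determines_root:
  assumes S: "tube G S" and v: "v \<in> S"
    and nb: "\<And>u. u \<in> nbhd S \<Longrightarrow> h u = h' u"
    and eqS: "coord (Round S) h = coord (Round S) h'"
    and eqC: "\<And>C. C \<in> comps (S - {v}) \<Longrightarrow> coord (Round C) h = coord (Round C) h'"
  shows "\<not> h v < h' v"
proof
  assume hv: "h v < h' v"
  let ?p = "\<lambda>h v. max 0 (h v) :: real" and ?q = "\<lambda>h v. max 0 (- h v) :: real"
  let ?K = "comps (S - {v})"
  have fS: "finite S" "S \<noteq> {}" using S finite_tube tube_nonempty by auto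
  have fC: "finite C" "C \<noteq> {}" if "C \<in> ?K" for C using comps_tube[OF that] finite_tube tube_nonempty by auto
  have UC: "\<Union> ?K = S - {v}" using tube_subset[OF S] by (intro Union_comps) auto
  \<comment> \<open>A neighbour of a component is either \<open>v\<close> or a neighbour of
    \<open>S\<close>.\<close>
  have le: "h u \<le> h' u" if C: "C \<in> ?K" and u: "u \<in> nbhd C" for C u
  proof (cases "u \<in> S")
    case True
    have "u = v"
    proof (rule ccontr)
      assume "u \<noteq> v"
      then obtain D where D: "D \<in> ?K" "u \<in> D" using True UC by blast
      then have "D \<noteq> C" using u by (auto simp: nbhd_def)
      then show False using comps_separated[OF C D(1)] D u by blast
    qed
    then show ?thesis using hv by simp
  next
    case False
    then have "u \<in> nbhd S" using u comps_subset[OF C] by (auto simp: nbhd_def)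
    then show ?thesis using nb by simp
  qed
  have vC: "v \<in> nbhd C" if C: "C \<in> ?K" for C
  proof -
    have "C \<inter> S \<noteq> {}" "\<not> S \<subseteq> C" using comps_subset[OF C] fC[OF C] v by auto
    then obtain u where u: "u \<in> nbhd C" "u \<in> S" using tube_crossing[OF S] by blast
    show ?thesis
    proof (rule ccontr)
      assume "v \<notin> nbhd C"
      then obtain D where D: "D \<in> ?K" "u \<in> D" using u UC by blast
      then have "D \<noteq> C" using u by (auto simp: nbhd_def)
      then show False using comps_separated[OF C D(1)] D u by blast
    qed
  qed
  \<comment> \<open>The balance falls strictly as the slack grows and does not fall as heights grow,
    so equal coordinates forbid a smaller slack for \<open>h'\<close>.\<close>
  have slack_le: "slack h C \<le> slack h' C" if C: "C \<in> ?K" for C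
  proof (rule ccontr)
    assume "\<not> ?thesis"
    then have "balance (nbhd C) h (slack h C) < balance (nbhd C) h (slack h' C)"
      using finite_nbhd by (intro balance_strict_antimono) auto
    also have "\<dots> \<le> balance (nbhd C) h' (slack h' C)" using finite_nbhd le[OF C] by (intro balance_mono)
    finally show False using eqC[OF C] by simp
  qed
  \<comment> \<open>Here \<open>v\<close> is high enough that raising it strictly raises the
    balance, which a larger slack must offset.\<close>
  have slack_less: "slack h C < slack h' C" if C: "C \<in> ?K" and "max 0 (slack h C) \<le> h v" for C
  proof (rule ccontr)
    assume "\<not> ?thesis"
    then have "slack h C = slack h' C" using slack_le[OF C] by simp
    moreover have "balance (nbhd C) h (slack h C) < balance (nbhd C) h' (slack h C)"
      using finite_nbhd le[OF C] vC[OF C] hv that(2) by (intro balance_strict_mono)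
    ultimately show False using eqC[OF C] by simp
  qed
  have slack_eq: "slack h S = slack h' S"
  proof -
    have "balance (nbhd S) h s = balance (nbhd S) h' s" for s
      using nb finite_nbhd by (intro antisym balance_mono) auto
    then show ?thesis
      using eqS balance_strict_antimono[OF finite_nbhd, of "slack h S" "slack h' S" S h]
        balance_strict_antimono[OF finite_nbhd, of "slack h' S" "slack h S" S h]
      by (cases "slack h S" "slack h' S" rule: linorder_cases) auto
  qed
  have qsum: "sum (?q f) S = ?q f v + (\<Sum>C\<in>?K. max 0 (- slack f C))" for f
  proof -
    have "sum (?q f) S = ?q f v + sum (?q f) (\<Union> ?K)" using fS v by (simp add: UC sum.remove)
    also have "sum (?q f) (\<Union> ?K) = (\<Sum>C\<in>?K. sum (?q f) C)"
      using fC(1) comps_separated by (subst sum.Union_disjoint) auto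
    also have "\<dots> = (\<Sum>C\<in>?K. max 0 (- slack f C))"
      using slack_parts(2)[OF fC] by (intro sum.cong) auto
    finally show ?thesis .
  qed
  have qeq: "sum (?q h) S = sum (?q h') S" using slack_eq slack_parts(2)[OF fS] by metis
  show False
  \<comment> \<open>With a negative height, the total negative part would strictly drop, at
    \<open>v\<close> or in a component with a negative vertex, although \<open>slack_eq\<close>
    keeps it fixed.\<close>
  proof (cases "\<exists>w\<in>S. h w < 0")
    case True
    have neg_le: "max 0 (- slack h' C) \<le> max 0 (- slack h C)" if "C \<in> ?K" for C
      using slack_le[OF that] by linarith
    then have mono: "(\<Sum>C\<in>?K. max 0 (- slack h' C)) \<le> (\<Sum>C\<in>?K. max 0 (- slack h C))"
      by (intro sum_mono)
    have v0: "0 \<le> h v"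
    proof (rule ccontr)
      assume "\<not> 0 \<le> h v"
      then have "?q h' v < ?q h v" using hv by auto
      then show False using mono qeq qsum[of h] qsum[of h'] by linarith
    qed
    then obtain w C where C: "C \<in> ?K" "w \<in> C" "h w < 0" using True UC by (metis DiffI Union_iff insertE empty_iff not_le)
    then have "0 < sum (?q h) C" using fC[OF C(1)] by (intro sum_pos2[of _ w]) auto
    then have neg: "slack h C < 0" using slack_parts(2)[OF fC[OF C(1)], of h] by (auto simp: max_def split: if_splits)
    then have "slack h C < slack h' C" using slack_less[OF C(1)] v0 by simp
    then have "(\<Sum>C\<in>?K. max 0 (- slack h' C)) < (\<Sum>C\<in>?K. max 0 (- slack h C))"
      using neg_le C(1) neg finite_comps by (intro sum_strict_mono_ex1) (auto intro!: bexI[of _ C])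
    moreover have "?q h' v \<le> ?q h v" using hv by auto
    ultimately show False using qeq qsum[of h] qsum[of h'] by linarith
  next
    case False
    then have q0: "sum (?q h) S = 0" by (intro sum.neutral) auto
    then have "\<forall>w\<in>S. ?q h' w = 0" using qeq fS sum_nonneg_eq_0_iff[of S "?q h'"] by simp
    then have pos': "0 \<le> h' w" if "w \<in> S" for w using that by force
    have pos: "0 \<le> h w" if "w \<in> S" for w using that False by (meson not_le)
    have leq: "low (?p h) S = low (?p h') S" using slack_eq slack_parts(1)[OF fS] by metis
    \<comment> \<open>Now the slack of \<open>S\<close> is its minimum. A vertex \<open>w\<close>
      attaining it for \<open>h'\<close> is not \<open>v\<close>, so it lies in a component; the
      slacks of that component for \<open>h\<close> and \<open>h'\<close> are both pinned to this
      minimum, against \<open>slack_less\<close>.\<close>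
    have "low (?p h') S \<in> ?p h' ` S" unfolding low_def using fS by (intro Min_in) auto
    then obtain w where w: "w \<in> S" "low (?p h') S = h' w" using pos' by auto
    have lowv: "low (?p h) S \<le> h v" 
    proof -
      have "low (?p h) S \<le> ?p h v" unfolding low_def using fS v by (intro Min_le) auto
      then show ?thesis using pos[OF v] by simp
    qed
    have "w \<noteq> v" using w leq lowv hv by auto
    then obtain C where C: "C \<in> ?K" "w \<in> C" using w UC by blast
    have CS: "C \<subseteq> S" using comps_subset[OF C(1)] by auto
    have sC: "slack f C = low (?p f) C" if "\<forall>w\<in>S. 0 \<le> f w" for f
    proof -
      have "sum (?q f) C = 0" using that CS by (intro sum.neutral) auto
      then show ?thesis by (simp add: slack_def)
    qed
    have "slack h' C = low (?p h') C" using sC pos' by blast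
    also have "\<dots> \<le> ?p h' w" unfolding low_def using fC[OF C(1)] C by (intro Min_le) auto
    also have "\<dots> = low (?p h) S" using w leq pos' by simp
    finally have upper: "slack h' C \<le> low (?p h) S" .
    have "low (?p h) S \<le> low (?p h) C" unfolding low_def using fS CS fC[OF C(1)] by (intro Min_antimono) auto
    also have "\<dots> = slack h C" using sC pos by simp
    finally have lower: "low (?p h) S \<le> slack h C" .
    have "slack h C = low (?p h) S" using slack_le[OF C(1)] upper lower by linarith
    moreover have "0 \<le> low (?p h) S" using fS by (rule low_pos_part_nonneg)
    ultimately have "slack h C < slack h' C" using slack_less[OF C(1)] lowv by simp
    then show False using upper lower by linarith
  qed
qed

section \<open>Maximal tubings\<close>

text \<open>Later arguments use maximality only in this form.\<close>

lemma maximal_memI: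
  assumes mx: "maximal_design_tubing G M" and T: "is_design_tube G T"
    and comp: "\<And>U. U \<in> M \<Longrightarrow> U \<noteq> T \<Longrightarrow> compatible_tubes G T U"
  shows "T \<in> M"
proof -
  have "design_tubing G (insert T M)"
    using mx T comp compatible_sym
    by (auto simp: maximal_design_tubing_def design_tubing_def pairwise_insert)
  then have "insert T M = M" using mx unfolding maximal_design_tubing_def by blast
  then show ?thesis by blast
qed

lemma maximal_design: "maximal_design_tubing G M \<Longrightarrow> T \<in> M \<Longrightarrow> is_design_tube G T"
  by (auto simp: maximal_design_tubing_def design_tubing_def)

lemma maximal_compatible:
  "maximal_design_tubing G M \<Longrightarrow> T \<in> M \<Longrightarrow> U \<in> M \<Longrightarrow> T \<noteq> U \<Longrightarrow> compatible_tubes G T U"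
  by (auto simp: maximal_design_tubing_def design_tubing_def pairwise_def)

lemma maximal_Round_compatible:
  "maximal_design_tubing G M \<Longrightarrow> Round S \<in> M \<Longrightarrow> Round T \<in> M \<Longrightarrow> compatible_tubes G (Round S) (Round T)"
  using maximal_compatible[of M "Round S" "Round T"] by (cases "S = T") auto

text \<open>In a maximal tubing each round tube is rooted at exactly one vertex.\<close>

definition rooted_at :: "'a design_tube set \<Rightarrow> 'a \<Rightarrow> 'a set \<Rightarrow> bool" where
  "rooted_at M v S \<longleftrightarrow> Round S \<in> M \<and> v \<in> S \<and> (\<forall>T. Round T \<in> M \<and> v \<in> T \<longrightarrow> S \<subseteq> T)"

text \<open>The round tubes of \<open>M\<close> through \<open>v\<close> form a chain by
  compatibility, and the smallest is rooted at \<open>v\<close>. If there are none,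
  \<open>[v]\<close> is compatible with all of \<open>M\<close> and so belongs to it.\<close>

lemma Square_or_rooted_at:
  assumes mx: "maximal_design_tubing G M" and v: "v \<in> pverts G"
  shows "Square v \<in> M \<or> (\<exists>S. rooted_at M v S)"
proof (rule disjCI)
  let ?F = "{S. tube G S \<and> (Round S \<in> M \<and> v \<in> S)}"
  assume n: "\<not> (\<exists>S. rooted_at M v S)"
  have "?F = {}"
  proof (rule ccontr)
    assume "?F \<noteq> {}"
    with finite_tubes have "\<exists>S\<in>?F. \<forall>T\<in>?F. T \<subseteq> S \<longrightarrow> S = T" by (intro finite_has_minimal)
    then obtain S where S: "S \<in> ?F" "\<forall>T\<in>?F. T \<subseteq> S \<longrightarrow> S = T" by (elim bexE)
    have "S \<subseteq> T" if T: "Round T \<in> M" "v \<in> T" for T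
    proof -
      have "T \<in> ?F" using T maximal_design[OF mx T(1)] by simp
      moreover have "S \<subseteq> T \<or> T \<subseteq> S"
        using maximal_Round_compatible[OF mx, of S T] S(1) T unfolding compatible_Round_iff by auto
      ultimately show ?thesis using S(2) by auto
    qed
    then have "rooted_at M v S" using S(1) by (simp add: rooted_at_def)
    then show False using n by blast
  qed
  then have none: "v \<notin> S" if "Round S \<in> M" for S using maximal_design[OF mx that] that by auto
  show "Square v \<in> M"
  proof (rule maximal_memI[OF mx])
    show "is_design_tube G (Square v)" using v by simp
    show "compatible_tubes G (Square v) U" if "U \<in> M" "U \<noteq> Square v" for U
      using none that by (cases U) auto
  qed
qed

text \<open>A round tube of \<open>M\<close> properly inside \<open>S\<close> avoids
  \<open>v\<close>, as \<open>S\<close> is the least one through \<open>v\<close>, and so lies in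
  one component. Any other tube of \<open>M\<close> contains \<open>S\<close>, is separated from it
  or is square at a vertex outside it, and so is compatible with \<open>C\<close>.\<close>

lemma rooted_at_comps:
  assumes mx: "maximal_design_tubing G M" and r: "rooted_at M v S" and C: "C \<in> comps (S - {v})"
  shows "Round C \<in> M"
proof (rule maximal_memI[OF mx])
  have S: "Round S \<in> M" "v \<in> S" using r by (auto simp: rooted_at_def)
  have CS: "C \<subseteq> S" "v \<notin> C" using comps_subset[OF C] by auto
  show "is_design_tube G (Round C)" using comps_tube[OF C] by simp
  fix U assume U: "U \<in> M" "U \<noteq> Round C"
  show "compatible_tubes G (Round C) U"
  proof (cases U)
    case (Square u)
    then have "compatible_tubes G (Round S) (Square u)" using maximal_compatible[OF mx S(1), of U] U by auto
    then show ?thesis using CS Square by auto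
  next
    case (Round T)
    then have T: "Round T \<in> M" "tube G T" using U maximal_design[OF mx, of U] by auto
    consider "S \<subseteq> T" | "T \<subseteq> S" "\<not> S \<subseteq> T" | "S \<inter> T = {}" "nbhd S \<inter> T = {}"
      using maximal_Round_compatible[OF mx S(1) T(1)] unfolding compatible_Round_iff by blast
    then show ?thesis unfolding Round compatible_Round_iff
    proof cases
      case 1
      then show "C \<subseteq> T \<or> T \<subseteq> C \<or> C \<inter> T = {} \<and> nbhd C \<inter> T = {}" using CS by blast
    next
      case 2
      then have "v \<notin> T" using r T(1) by (auto simp: rooted_at_def)
      then have "T \<subseteq> S - {v}" using 2 by blast
      then obtain D where D: "D \<in> comps (S - {v})" "T \<subseteq> D" using T(2) by (elim tube_subset_comp)
      then show "C \<subseteq> T \<or> T \<subseteq> C \<or> C \<inter> T = {} \<and> nbhd C \<inter> T = {}"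
        using comps_separated[OF C D(1)] by (cases "C = D") auto
    next
      case 3
      then have "nbhd C \<inter> T = {}" using CS by (auto simp: nbhd_def)
      then show "C \<subseteq> T \<or> T \<subseteq> C \<or> C \<inter> T = {} \<and> nbhd C \<inter> T = {}" using 3 CS by blast
    qed
  qed
qed

text \<open>Descend through the forest of round tubes: the neighbours of a tube are square or roots of
  larger tubes.\<close>

lemma coords_determine_height:
  assumes mx: "maximal_design_tubing G M"
    and eq: "\<And>T. T \<in> M \<Longrightarrow> coord T h = coord T h'" and v: "v \<in> pverts G"
  shows "h v = h' v"
proof -
  have "h v = h' v" if "rooted_at M v S" for v S
    using that
  proof (induction "card (pverts G) - card S" arbitrary: v S rule: less_induct)
    case less
    have S: "Round S \<in> M" "v \<in> S" using less.prems by (auto simp: rooted_at_def)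
    have tS: "tube G S" using maximal_design[OF mx S(1)] by simp
    have nb: "h u = h' u" if u: "u \<in> nbhd S" for u
    proof (cases "Square u \<in> M")
      case True
      then show ?thesis using eq[OF True] by simp
    next
      case False
      have "u \<in> pverts G" using u nbhd_subset by blast
      then obtain T where T: "rooted_at M u T" using Square_or_rooted_at[OF mx] False by blast
      then have TM: "Round T \<in> M" "u \<in> T" by (auto simp: rooted_at_def)
      have "u \<notin> S" using u by (simp add: nbhd_def)
      then have "S \<subset> T"
        using maximal_Round_compatible[OF mx S(1) TM(1)] u TM(2) unfolding compatible_Round_iff by blast
      moreover have tT: "tube G T" using maximal_design[OF mx TM(1)] by simp
      ultimately have "card S < card T" using finite_tube by (auto intro: psubset_card_mono)
      moreover have "card T \<le> card (pverts G)" using pair_finite_verts tube_subset[OF tT] by (rule card_mono)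
      ultimately have "card (pverts G) - card T < card (pverts G) - card S" by simp
      then show ?thesis using less.hyps[OF _ T] by simp
    qed
    have eqC: "coord (Round C) h = coord (Round C) h'" if "C \<in> comps (S - {v})" for C
      using eq[OF rooted_at_comps[OF mx less.prems that]] .
    have "\<not> h v < h' v"
      by (rule coord_Round_determines_root[OF tS S(2) nb eq[OF S(1)] eqC])
    moreover have "\<not> h' v < h v"
      by (rule coord_Round_determines_root[OF tS S(2) nb[symmetric] eq[OF S(1), symmetric] eqC[symmetric]])
    ultimately show ?case by linarith
  qed
  moreover have "h v = h' v" if "Square v \<in> M" using eq[OF that] by simp
  ultimately show ?thesis using Square_or_rooted_at[OF mx v] by blast
qed

section \<open>A bijection between the vertices and the tubes of a maximal tubing\<close>

lemma Round_rooted_at: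
  assumes mx: "maximal_design_tubing G M" and S: "Round S \<in> M"
  obtains v where "v \<in> S" "rooted_at M v S"
proof -
  let ?F = "{T. tube G T \<and> (Round T \<in> M \<and> \<not> S \<subseteq> T)}"
  have tS: "tube G S" using maximal_design[OF mx S] by simp
  \<comment> \<open>A vertex of \<open>S\<close> missed by all these tubes will be the root.\<close>
  have "\<not> S \<subseteq> \<Union> ?F"
  proof
    assume "S \<subseteq> \<Union> ?F"
    then obtain T where "T \<in> ?F" "S \<subseteq> T"
      using maximal_Round_compatible[OF mx] by (elim compatible_cover[OF tS finite_tubes]) auto
    then show False by simp
  qed
  then obtain v where v: "v \<in> S" "v \<notin> \<Union> ?F" by blast
  have "S \<subseteq> T" if "Round T \<in> M" "v \<in> T" for T using v that maximal_design[OF mx that(1)] by auto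
  then show thesis using that[OF v(1)] S v(1) by (simp add: rooted_at_def)
qed

text \<open>Each vertex corresponds to its square tube or to the round tube rooted at it. Heights
  and coordinates thus span spaces of equal dimension, as invariance of domain requires.\<close>

lemma bij_betw_vertices_maximal_tubing:
  assumes mx: "maximal_design_tubing G M"
  shows "\<exists>f. bij_betw f (pverts G) M"
proof -
  define R where "R v T \<longleftrightarrow> T \<in> M \<and> (T = Square v \<or> (\<exists>S. T = Round S \<and> rooted_at M v S))" for v T
  have "\<exists>T. R v T" if "v \<in> pverts G" for v
    using Square_or_rooted_at[OF mx that] by (auto simp: R_def rooted_at_def)
  then obtain f where f: "\<And>v. v \<in> pverts G \<Longrightarrow> R v (f v)" by metis
  have no_both: "\<not> rooted_at M v S" if "Square v \<in> M" for v S
  proof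
    assume "rooted_at M v S"
    then have "Round S \<in> M" "v \<in> S" by (auto simp: rooted_at_def)
    then show False using maximal_compatible[OF mx that, of "Round S"] by auto
  qed
  have R_unique: "T = U" if "R v T" "R v U" for v T U
    using that no_both[of v] by (auto simp: R_def rooted_at_def)
  \<comment> \<open>A second root \<open>w\<close> of \<open>S\<close> would lie in a component of
    \<open>S - {v}\<close>, a smaller tube of \<open>M\<close> containing \<open>w\<close>.\<close>
  have R_inj: "v = w" if RT: "R v T" "R w T" for v w T
  proof (rule ccontr)
    assume ne: "v \<noteq> w"
    then obtain S where S: "T = Round S" "rooted_at M v S" "rooted_at M w S" using RT by (auto simp: R_def)
    have "Round S \<in> M" "w \<in> S" using S by (auto simp: rooted_at_def)
    then have "w \<in> S - {v}" "S - {v} \<subseteq> pverts G"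
      using ne maximal_design[OF mx, of "Round S"] tube_subset[of S] by auto
    then obtain C where C: "C \<in> comps (S - {v})" "w \<in> C" using Union_comps by blast
    then have "S \<subseteq> C" using rooted_at_comps[OF mx S(2) C(1)] S(3) by (simp add: rooted_at_def)
    then show False using comps_subset[OF C(1)] S(2) by (auto simp: rooted_at_def)
  qed
  have "T \<in> f ` pverts G" if T: "T \<in> M" for T
  proof -
    obtain v where "R v T" "v \<in> pverts G"
    proof (cases T)
      case (Round S)
      then obtain v where "v \<in> S" "rooted_at M v S" using Round_rooted_at[OF mx, of S] T by blast
      then show thesis using that[of v] T Round maximal_design[OF mx T] tube_subset[of S] by (auto simp: R_def)
    next
      case (Square v)
      then show thesis using that[of v] T maximal_design[OF mx T] by (auto simp: R_def)
    qed
    then show ?thesis using f R_unique by blast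
  qed
  moreover have "f v \<in> M" if "v \<in> pverts G" for v using f[OF that] by (simp add: R_def)
  moreover have "inj_on f (pverts G)" using f R_inj by (metis inj_onI)
  ultimately show ?thesis by (intro exI[of _ f]) (auto simp: bij_betw_def)
qed

section \<open>Homogeneity, continuity and surjectivity of the coordinates\<close>

lemma coord_scale:
  assumes D: "is_design_tube G D" and t: "0 \<le> t"
  shows "coord D (\<lambda>v. t * h v) = t * coord D h"
proof (cases D)
  case (Round S)
  have fS: "finite S" "S \<noteq> {}" using D Round finite_tube tube_nonempty by auto
  have m: "mono (\<lambda>x::real. t * x)" using t by (intro monoI mult_left_mono)
  have pos: "max 0 (t * x) = t * max 0 x" for x using t by (simp add: max_mult_distrib_left)
  have neg: "max 0 (- (t * x)) = t * max 0 (- x)" for x using pos[of "- x"] by simp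
  have low: "low (\<lambda>v. t * p v) S = t * low p S" for p
    unfolding low_def using mono_Min_commute[OF m, of "p ` S"] fS by (simp add: image_image)
  have high: "high (\<lambda>v. t * p v) (nbhd S) = t * high p (nbhd S)" for p
    unfolding high_def using mono_Max_commute[OF m, of "insert 0 (p ` nbhd S)"] finite_nbhd
    by (simp add: image_image)
  have slack: "slack (\<lambda>v. t * h v) S = t * slack h S"
    by (simp add: slack_def pos neg low sum_distrib_left[symmetric] right_diff_distrib)
  show ?thesis
    unfolding Round coord.simps slack balance_def
    by (simp add: pos neg high sum_distrib_left[symmetric] right_diff_distrib[symmetric] distrib_left[symmetric])
qed simp

lemma continuous_on_coord:
  assumes D: "is_design_tube G D" and f: "\<And>v. continuous_on A (\<lambda>x. f x v)"
  shows "continuous_on A (\<lambda>x. coord D (f x))"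
proof (cases D)
  case (Round S)
  have fS: "finite S" "S \<noteq> {}" using D Round finite_tube tube_nonempty by auto
  have low: "continuous_on A (\<lambda>x. low (p x) S)" if p: "\<And>v. continuous_on A (\<lambda>x. p x v)"
    for p :: "_ \<Rightarrow> 'a \<Rightarrow> real"
    using fS
  proof (induction S rule: finite_ne_induct)
    case (singleton v)
    then show ?case using p by (simp add: low_def)
  next
    case (insert v S)
    then show ?case using p by (simp add: low_insert continuous_on_min)
  qed
  have high: "continuous_on A (\<lambda>x. high (p x) N)" if p: "\<And>v. continuous_on A (\<lambda>x. p x v)" and "finite N"
    for p :: "_ \<Rightarrow> 'a \<Rightarrow> real" and N
    using \<open>finite N\<close>
  proof (induction N)
    case empty
    then show ?case by (simp add: high_def)
  next
    case (insert v N)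
    have "high q (insert v N) = max (q v) (high q N)" for q :: "'a \<Rightarrow> real"
      using insert.hyps by (simp add: high_def insert_commute[of 0])
    then show ?case using insert.IH p by (simp add: continuous_on_max)
  qed
  have "continuous_on A (\<lambda>x. slack (f x) S)"
    unfolding slack_def using f by (intro continuous_intros low)
  then show ?thesis
    unfolding Round coord.simps balance_def using f finite_nbhd by (intro continuous_intros high)
next
  case (Square v)
  then show ?thesis using f by simp
qed

text \<open>The coordinates form an injective continuous positively homogeneous map, whose range is a
  neighbourhood of the origin by invariance of domain.\<close>

lemma coords_surj:
  fixes T0 :: "'n::finite \<Rightarrow> 'a design_tube" and x :: "real ^ 'n"
  assumes inj: "inj T0" and mx: "maximal_design_tubing G (range T0)"
  shows "\<exists>h. (\<forall>v. v \<notin> pverts G \<longrightarrow> h v = 0) \<and> (\<forall>i. coord (T0 i) h = x $ i)"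
proof -
  obtain f where f: "bij_betw f (pverts G) (range T0)" using bij_betw_vertices_maximal_tubing[OF mx] by blast
  \<comment> \<open>Indices are identified with vertices, so that vectors become height functions
    vanishing outside the graph.\<close>
  define \<sigma> where "\<sigma> = inv T0 \<circ> f"
  have \<sigma>: "bij_betw \<sigma> (pverts G) UNIV"
    unfolding \<sigma>_def using f inj by (intro bij_betw_trans[OF f] bij_betw_inv_into) (simp add: inj_on_imp_bij_betw)
  define H where "H y v = (if v \<in> pverts G then y $ \<sigma> v else 0)" for y :: "real ^ 'n" and v
  define F where "F y = (\<chi> i. coord (T0 i) (H y))" for y
  have des: "is_design_tube G (T0 i)" for i using maximal_design[OF mx] by blast
  have "inj F"
  proof (rule injI)
    fix y z assume "F y = F z"
    then have "coord (T0 i) (H y) = coord (T0 i) (H z)" for i by (simp add: F_def vec_eq_iff)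
    then have eq: "H y v = H z v" if "v \<in> pverts G" for v using coords_determine_height[OF mx _ that] by blast
    show "y = z"
    proof (rule vec_eq_iff[THEN iffD2], rule allI)
      fix i
      obtain v where "v \<in> pverts G" "\<sigma> v = i" using \<sigma> by (metis UNIV_I bij_betw_imp_surj_on imageE)
      then show "y $ i = z $ i" using eq[of v] by (simp add: H_def)
    qed
  qed
  moreover have "continuous_on UNIV F"
  proof -
    have "continuous_on UNIV (\<lambda>y. H y v)" for v
      by (cases "v \<in> pverts G") (auto simp: H_def intro!: continuous_intros)
    then show ?thesis unfolding F_def using des by (intro continuous_on_vec_lambda continuous_on_coord)
  qed
  ultimately have "open (range F)" by (intro invariance_of_domain) auto
  moreover have scale: "F (t *\<^sub>R y) = t *\<^sub>R F y" if "0 \<le> t" for t y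
  proof -
    have "H (t *\<^sub>R y) = (\<lambda>v. t * H y v)" by (auto simp: H_def)
    then show ?thesis using coord_scale[OF des that] by (simp add: F_def vec_eq_iff)
  qed
  moreover have "0 \<in> range F" using scale[of 0 0] by (metis order_refl rangeI scaleR_zero_left)
  ultimately obtain r where r: "0 < r" "ball 0 r \<subseteq> range F" by (meson open_contains_ball)
  \<comment> \<open>The added \<open>1\<close> avoids a zero denominator and makes the norm of
    \<open>t x\<close> strictly less than \<open>r\<close>.\<close>
  define t where "t = r / (norm x + 1)"
  have t: "0 < t" using r by (simp add: t_def add_nonneg_pos)
  have "norm (t *\<^sub>R x) < r"
  proof -
    have "norm (t *\<^sub>R x) = r * (norm x / (norm x + 1))" using r by (simp add: t_def)
    also have "\<dots> < r * 1" using r by (intro mult_strict_left_mono) (auto simp: divide_less_eq add_nonneg_pos)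
    finally show ?thesis by simp
  qed
  then have "t *\<^sub>R x \<in> ball 0 r" by (simp only: mem_ball_0)
  then obtain y where "t *\<^sub>R x = F y" using r(2) by blast
  then have "F ((1 / t) *\<^sub>R y) = x" using scale[of "1 / t" y] t by (simp flip: \<open>t *\<^sub>R x = F y\<close>)
  then have "coord (T0 i) (H ((1 / t) *\<^sub>R y)) = x $ i" for i by (auto simp: F_def)
  then show ?thesis by (intro exI[of _ "H ((1 / t) *\<^sub>R y)"]) (auto simp: H_def)
qed

text \<open>Existence: every vector consists of the coordinates of some height function, and this is
  the height of a weighting. Uniqueness: the coordinates determine the height, and the height
  determines the weighting.\<close>

lemma conic_coordinates_design:
  fixes T0 :: "'n::finite \<Rightarrow> 'a design_tube"
  assumes inj: "inj T0" and mx: "maximal_design_tubing G (range T0)"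
  shows "conic_coordinates {T. is_design_tube G T} (design_nested_complex G) (compat_vector G T0)"
proof
  have des: "is_design_tube G (T0 i)" for i using maximal_design[OF mx] by blast
  let ?X = "{T. is_design_tube G T}"
  have vec: "(\<Sum>T\<in>?X. c T *\<^sub>R compat_vector G T0 T) = (\<chi> i. coord (T0 i) (height c))" if "weighting c" for c
    using sum_compat_degree[OF that des] by (simp add: vec_eq_iff compat_vector_def)
  show "finite ?X" by (rule finite_design_tubes)
  show "A \<subseteq> ?X" if "A \<in> design_nested_complex G" for A
    using that by (auto simp: design_nested_complex_def design_tubing_def)
  show "B \<in> design_nested_complex G" if "A \<in> design_nested_complex G" "B \<subseteq> A" for A B
    using that by (auto simp: design_nested_complex_def design_tubing_def intro: pairwise_subset)
  show "\<exists>c. (\<forall>T. 0 \<le> c T) \<and> {T. c T \<noteq> 0} \<in> design_nested_complex G \<and> x = (\<Sum>T\<in>?X. c T *\<^sub>R compat_vector G T0 T)"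
    for x :: "real ^ 'n"
  proof -
    obtain h where h: "\<And>v. v \<notin> pverts G \<Longrightarrow> h v = 0" "\<And>i. coord (T0 i) h = x $ i"
      using coords_surj[OF inj mx] by blast
    obtain c where c: "weighting c" "height c = h" using height_surj[of h] h(1) by blast
    then show ?thesis using vec[OF c(1)] h(2)
      by (intro exI[of _ c]) (auto simp: weighting_def design_nested_complex_def vec_eq_iff)
  qed
  show "c = c'"
    if "\<forall>T. 0 \<le> c T" "{T. c T \<noteq> 0} \<in> design_nested_complex G"
      "\<forall>T. 0 \<le> c' T" "{T. c' T \<noteq> 0} \<in> design_nested_complex G"
      "(\<Sum>T\<in>?X. c T *\<^sub>R compat_vector G T0 T) = (\<Sum>T\<in>?X. c' T *\<^sub>R compat_vector G T0 T)" for c c'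
  proof -
    have w: "weighting c" "weighting c'" using that by (auto simp: weighting_def design_nested_complex_def)
    then have "coord (T0 i) (height c) = coord (T0 i) (height c')" for i
      using that(5) vec by (simp add: vec_eq_iff)
    then show ?thesis using coords_determine_height[OF mx] by (intro weighting_eqI[OF w]) blast
  qed
qed

end

section \<open>The fan of compatibility cones\<close>

theorem theorem5p24:
  fixes G :: "'a pair_pre_digraph"
    and T0 :: "'n::finite \<Rightarrow> 'a design_tube"
  assumes "pair_graph G"
    and "inj T0"
    and "maximal_design_tubing G (range T0)"
  shows "complete_simplicial_fan (design_compat_fan G T0) \<and>
    (\<forall>\<T>. design_tubing G \<T> \<longrightarrow>
       inj_on (compat_vector G T0) \<T> \<and> independent (compat_vector G T0 ` \<T>)) \<and>
    bij_betw (tubing_cone G T0) (design_nested_complex G) (design_compat_fan G T0) \<and>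
    (\<forall>\<T>\<in>design_nested_complex G. \<forall>\<T>'\<in>design_nested_complex G.
       \<T> \<subseteq> \<T>' \<longleftrightarrow> tubing_cone G T0 \<T> face_of tubing_cone G T0 \<T>')"
proof -
  interpret conic_coordinates "{T. is_design_tube G T}" "design_nested_complex G" "compat_vector G T0"
    using pair_graph.conic_coordinates_design[OF assms] .
  have cone: "tubing_cone G T0 = cone_over" by (simp add: fun_eq_iff tubing_cone_def cone_over_def)
  show ?thesis
    unfolding design_compat_fan_def cone
    using complete_simplicial_fan_cones inj_on_gen independent_gen inj_on_cone_over cone_over_face_iff
    by (auto simp: bij_betw_def design_nested_complex_def)
qed

end
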